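(* Let $T\colon X\to X$ be an open continuous distance-expanding map on a compact metric space $(X,d)$, and let $A\colon X\to\mathbb{R}$ be $\alpha$-Hölder continuous with $\alpha\in(0,1]$. Let $\phi_A\colon X\times X\to\mathbb{R}\cup\{-\infty\}$ be the Mañé potential associated with $A$ and $\Omega_A$ the Aubry set with respect to $A$. Then the following statements are true: (i) If there exists a tropical eigenfunction $v$ of $\mathcal{L}_A$, then the identity $v(y)=\bigoplus_{x\in\Omega_A}(v(x)\otimes\phi_A(x,y))$ holds for every $y\in X$. (ii) For every tropical eigen-density $b$ of $\mathcal{L}_A^{\circledast}$, $b(\cdot)$ is equivalent to $\bigoplus_{y\in\Omega_A}(\phi_A(\cdot,y)\otimes b(y))$, i.e., $$\bigoplus_{x\in X}(f(x)\otimes b(x))=\bigoplus_{x\in X,\,y\in\Omega_A}(f(x)\otimes\phi_A(x,y)\otimes b(y))$$ for every $f\in C(X,\mathbb{R})$. (iii) If $A$ is uniquely maximizing, then the entries of $\{\phi_A(x,\cdot)\}_{x\in\Omega_A}$ (resp. $\{\phi_A(\cdot,y)\}_{y\in\Omega_A}$) are the same up to a tropical multiplicative constant. The entries of $\{\phi_A(\cdot,y)\}_{y\in\Omega_A}$ are tropical eigen-densities of $\mathcal{L}_A^{\circledast}$. If $T$ is in addition transitive, then the entries of $\{\phi_A(x,\cdot)\}_{x\in\Omega_A}$ are tropical eigenfunctions of $\mathcal{L}_A$.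
   Context: $T$ is distance-expanding if there exist $\lambda>1$, $\eta>0$ such that $d(x,y)\le2\eta$ implies $d(Tx,Ty)\ge\lambda d(x,y)$. Transitive means topologically transitive. $\mathbb{N}$ is the set of positive integers. $C(X,\mathbb{R})$ is the space of continuous functions $X\to\mathbb{R}$. $\overline{\mathbb{R}}_{\max}=\mathbb{R}\cup\{\pm\infty\}$; $\oplus$ means supremum, $x\otimes y=x+y$, with conventions $(-\infty)\otimes(+\infty)=-\infty$, $\sup\emptyset=-\infty$; operations on functions are pointwise. "Up to a tropical multiplicative constant" means up to addition of a constant. $Q(T,A)=\sup\{\int A\,\mathrm{d}\mu:\mu\text{ a }T\text{-invariant Borel probability measure}\}$ and $\overline{A}=A-Q(T,A)$. $A$ is uniquely maximizing if exactly one $T$-invariant Borel probability measure attains this supremum. $S_n\overline{A}(x)=\sum_{i=0}^{n-1}\overline{A}(T^i(x))$. Bousch operator: $\mathcal{L}_A(u)(x)=\sup_{y\in T^{-1}(x)}\{u(y)+A(y)\}$. Densities: $D_{\max}(X)=\{b\colon X\to\mathbb{R}\cup\{-\infty\}\text{ upper semi-continuous}\}\cup\{+\infty\}$. Tropical adjoint: $\mathcal{L}_A^{\circledast}(b)(x)=b(T(x))\otimes A(x)$ for $b\in D_{\max}(X)$. A tropical eigenfunction of $\mathcal{L}_A$ is $u\in C(X,\mathbb{R})$ with $\mathcal{L}_A(u)=u\otimes\kappa$ for some $\kappa\in\overline{\mathbb{R}}_{\max}$. A tropical eigen-density of $\mathcal{L}_A^{\circledast}$ is $b\in D_{\max}(X)\setminus\{+\infty,-\infty\}$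 ($\pm\infty$ being the constant functions) with $\mathcal{L}_A^{\circledast}(b)=b\otimes\kappa$ for some $\kappa\in\overline{\mathbb{R}}_{\max}$. Aubry set: $\Omega_A$ is the set of $x\in X$ such that for every $\epsilon>0$ there exist $y\in X$ and $n\in\mathbb{N}$ with $d(x,y)\le\epsilon$, $d(T^n(y),x)\le\epsilon$ and $|S_n\overline{A}(y)|\le\epsilon$. Mañé potential: $\phi_A(x,y)=\lim_{\epsilon\to0^+}\sup_{n\in\mathbb{N}}\sup\{S_n\overline{A}(z): z\in X,\ d(z,x)\le\epsilon,\ d(T^n(z),y)\le\epsilon\}$.
   Formalization: Part (ii) is proved for eigen-densities b when T is transitive or b has eigenvalue Q(T,A); otherwise it fails, e.g. T the identity on two points p,q with A(p)=0, A(q)=1, b(p)=0, b(q)=-∞. *)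

theory Defs
  imports "HOL-Probability.Probability"
begin

(* A compact metric space is a type of class metric_space with compact UNIV.
   Tropical scalars are extended reals and the tropical sum is the supremum;
   the empty supremum in ereal is -\<infinity>, as required. *)

(* The library's ereal addition has -\<infinity> + \<infinity> = \<infinity>,
   whereas tropical multiplication needs -\<infinity>. *)
definition trop_mult :: "ereal \<Rightarrow> ereal \<Rightarrow> ereal" (infixl \<open>\<otimes>\<^sub>t\<close> 70) where
  "a \<otimes>\<^sub>t b = (if a = -\<infinity> \<or> b = -\<infinity> then -\<infinity> else a + b)"

definition distance_expanding :: "('a::metric_space \<Rightarrow> 'a) \<Rightarrow> bool" where
  "distance_expanding T \<longleftrightarrow>
     (\<exists>r>1. \<exists>\<eta>>0. \<forall>x y. dist x y \<le> 2 * \<eta> \<longrightarrow> dist (T x) (T y) \<ge> r * dist x y)"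

definition topologically_transitive :: "('a::topological_space \<Rightarrow> 'a) \<Rightarrow> bool" where
  "topologically_transitive T \<longleftrightarrow>
     (\<forall>U V. open U \<longrightarrow> open V \<longrightarrow> U \<noteq> {} \<longrightarrow> V \<noteq> {} \<longrightarrow>
        (\<exists>n. (T ^^ n) ` U \<inter> V \<noteq> {}))"

definition holder_continuous :: "real \<Rightarrow> ('a::metric_space \<Rightarrow> real) \<Rightarrow> bool" where
  "holder_continuous \<alpha> A \<longleftrightarrow> (\<exists>C. \<forall>x y. \<bar>A x - A y\<bar> \<le> C * dist x y powr \<alpha>)"

definition invariant_measures :: "('a::topological_space \<Rightarrow> 'a) \<Rightarrow> 'a measure set" where
  "invariant_measures T =
     {\<mu>. prob_space \<mu> \<and> sets \<mu> = sets borel \<and> distr \<mu> borel T = \<mu>}"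

(* For continuous T and A on a compact space this is the supremum of a nonempty
   (Krylov--Bogolyubov) bounded set of reals. *)
definition maximal_energy :: "('a::topological_space \<Rightarrow> 'a) \<Rightarrow> ('a \<Rightarrow> real) \<Rightarrow> real" where
  "maximal_energy T A = (SUP \<mu>\<in>invariant_measures T. \<integral>x. A x \<partial>\<mu>)"

definition uniquely_maximizing :: "('a::topological_space \<Rightarrow> 'a) \<Rightarrow> ('a \<Rightarrow> real) \<Rightarrow> bool" where
  "uniquely_maximizing T A \<longleftrightarrow>
     (\<exists>!\<mu>. \<mu> \<in> invariant_measures T \<and> (\<integral>x. A x \<partial>\<mu>) = maximal_energy T A)"

definition normalized :: "('a::topological_space \<Rightarrow> 'a) \<Rightarrow> ('a \<Rightarrow> real) \<Rightarrow> 'a \<Rightarrow> real" where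
  "normalized T A x = A x - maximal_energy T A"

definition birkhoff_sum :: "('a \<Rightarrow> 'a) \<Rightarrow> ('a \<Rightarrow> real) \<Rightarrow> nat \<Rightarrow> 'a \<Rightarrow> real" where
  "birkhoff_sum T A n x = (\<Sum>i<n. A ((T ^^ i) x))"

definition bousch :: "('a \<Rightarrow> 'a) \<Rightarrow> ('a \<Rightarrow> real) \<Rightarrow> ('a \<Rightarrow> ereal) \<Rightarrow> 'a \<Rightarrow> ereal" where
  "bousch T A u x = (SUP y\<in>T -` {x}. u y \<otimes>\<^sub>t ereal (A y))"

definition bousch_adjoint :: "('a \<Rightarrow> 'a) \<Rightarrow> ('a \<Rightarrow> real) \<Rightarrow> ('a \<Rightarrow> ereal) \<Rightarrow> 'a \<Rightarrow> ereal" where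
  "bousch_adjoint T A b x = b (T x) \<otimes>\<^sub>t ereal (A x)"

(* C(X,R), viewed inside the extended-real-valued functions. *)
definition real_continuous_functions :: "('a::topological_space \<Rightarrow> ereal) set" where
  "real_continuous_functions = {\<lambda>x. ereal (v x) | v. continuous_on UNIV v}"

definition tropical_densities :: "('a::topological_space \<Rightarrow> ereal) set" where
  "tropical_densities =
     {b. (\<forall>x. b x \<noteq> \<infinity>) \<and> (\<forall>c::real. open {x. b x < ereal c})} \<union> {\<lambda>x. \<infinity>}"

definition tropical_eigenfunction ::
    "('a::topological_space \<Rightarrow> 'a) \<Rightarrow> ('a \<Rightarrow> real) \<Rightarrow> ('a \<Rightarrow> ereal) \<Rightarrow> bool" where
  "tropical_eigenfunction T A u \<longleftrightarrow>
     u \<in> real_continuous_functions \<and> (\<exists>\<kappa>::ereal. bousch T A u = (\<lambda>x. u x \<otimes>\<^sub>t \<kappa>))"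

definition tropical_eigendensity ::
    "('a::topological_space \<Rightarrow> 'a) \<Rightarrow> ('a \<Rightarrow> real) \<Rightarrow> ('a \<Rightarrow> ereal) \<Rightarrow> bool" where
  "tropical_eigendensity T A b \<longleftrightarrow>
     b \<in> tropical_densities - {\<lambda>x. \<infinity>, \<lambda>x. -\<infinity>} \<and>
     (\<exists>\<kappa>::ereal. bousch_adjoint T A b = (\<lambda>x. b x \<otimes>\<^sub>t \<kappa>))"

definition aubry_set :: "('a::metric_space \<Rightarrow> 'a) \<Rightarrow> ('a \<Rightarrow> real) \<Rightarrow> 'a set" where
  "aubry_set T A =
     {x. \<forall>\<epsilon>>0. \<exists>y. \<exists>n\<ge>1. dist x y \<le> \<epsilon> \<and> dist ((T ^^ n) y) x \<le> \<epsilon> \<and>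
            \<bar>birkhoff_sum T (normalized T A) n y\<bar> \<le> \<epsilon>}"

(* The expression under the limit is monotone in \<epsilon>, so the limit always exists in ereal. *)
definition mane_potential ::
    "('a::metric_space \<Rightarrow> 'a) \<Rightarrow> ('a \<Rightarrow> real) \<Rightarrow> 'a \<Rightarrow> 'a \<Rightarrow> ereal" where
  "mane_potential T A x y =
     Lim (at_right (0::real)) (\<lambda>\<epsilon>. SUP n\<in>{1..}.
       SUP z\<in>{z. dist z x \<le> \<epsilon> \<and> dist ((T ^^ n) z) y \<le> \<epsilon>}.
         ereal (birkhoff_sum T (normalized T A) n z))"

end

theory Submission
  imports Defs
begin

text \<open>Everything is expressed through approximate orbit segments. A real number \<open>c\<close> lies below the
Mane potential \<open>\<phi>(x, y)\<close> iff there are segments that start near \<open>x\<close>, end near \<open>y\<close> and have normalised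
Birkhoff sum near \<open>c\<close> or larger (\<open>mane_potential_ge_iff\<close>). An open expanding map has contracting inverse branches, so the endpoint of
a segment can be moved slightly, at a cost that does not depend on its length (\<open>expanding_pullback\<close>). Hence
segments can be concatenated, which is the triangle inequality for \<open>\<phi>\<close> (\<open>reach_trans\<close>), and a segment that nearly closes up
can be repeated for ever. Together with the Krylov-Bogolyubov theorem, which turns long segments into invariant measures, this bounds all normalised
Birkhoff sums from above (\<open>birkhoff_sums_bounded_above\<close>) and makes \<open>\<phi>\<close> smaller than \<open>\<infinity>\<close>.

Both representations follow an orbit and take an accumulation point. An eigenfunction \<open>v\<close> is exact
along some preimage of each point; a backward orbit of such preimages of \<open>y\<close> accumulates in the Aubry set, because Birkhoff sums along it are increments of
\<open>v\<close>, and the accumulation point attains the supremum (\<open>eigenfunction_representation\<close>). For an eigendensity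
\<open>b\<close> the forward orbit of \<open>x\<close> plays the same role; there the upper bound on Birkhoff sums keeps \<open>b\<close> bounded
below along the orbit, and upper semicontinuity replaces continuity
(\<open>density_attained_on_aubry_set\<close>). This needs the eigenvalue to be the maximal energy, which under transitivity holds since \<open>b\<close> is then
finite on a dense set (\<open>transitive_eigendensity_eigenvalue\<close>).

A point \<open>x\<close> of the Aubry set lies in a closed static class that contains its orbit, and the empirical measures of this
orbit converge along a subsequence to a maximizing measure carried by the class (\<open>maximizing_measure_on_linked_class\<close>). If the maximizing
measure is unique, any two classes meet and thus coincide, and within a class the triangle inequality makes the potentials differ by
constants. Splitting off the first step of a segment gives the eigenvalue equation for \<open>\<phi>(\<cdot>, y)\<close>, splitting off the last
step that for \<open>\<phi>(x, \<cdot>)\<close>. Loops at \<open>x\<close> can be made arbitrarily long, so that endpoints may even be moved by a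
fixed distance; this gives continuity of \<open>\<phi>(x, \<cdot>)\<close> and, with transitivity, its finiteness
(\<open>reach_move_endpoint\<close>, \<open>mane_potential_finite_if_transitive\<close>).

The Krylov-Bogolyubov theorem is obtained by coding the compact space measurably into the real line and
applying Helly's selection theorem there (\<open>compact_metric_weak_sequential_compactness\<close>).\<close>

section \<open>Weak limits of measures on a compact metric space\<close>

text \<open>The first differing digit dominates: all later digits together contribute at most half of its
weight. This is the gap that makes the Cantor-type code below invertible with uniform control.\<close>
lemma ternary_first_difference:
  fixes p q :: "nat \<Rightarrow> real"
  assumes p: "\<And>n. p n = 0 \<or> p n = 1" and q: "\<And>n. q n = 0 \<or> q n = 1"
    and close: "\<bar>(\<Sum>n. p n * (1/3)^n) - (\<Sum>n. q n * (1/3)^n)\<bar> < (1/3)^N / 2"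
  shows "\<forall>n\<le>N. p n = q n"
proof (rule ccontr)
  assume "\<not> ?thesis"
  then have ex: "\<exists>n. n \<le> N \<and> p n \<noteq> q n" by auto
  define m where "m = (LEAST n. n \<le> N \<and> p n \<noteq> q n)"
  have m: "m \<le> N" "p m \<noteq> q m"
    using LeastI_ex[OF ex] by (auto simp: m_def)
  have before: "p n = q n" if "n < m" for n
    using not_less_Least[of n "\<lambda>n. n \<le> N \<and> p n \<noteq> q n"] that m by (auto simp: m_def)
  define d where "d n = p n - q n" for n
  have dle: "\<bar>d n\<bar> \<le> 1" for n using p[of n] q[of n] by (auto simp: d_def)
  have geo: "summable (\<lambda>n. (1/3::real)^n)" by (intro summable_geometric) auto
  have pb: "\<bar>p n\<bar> * (1/3)^n \<le> (1/3)^n" and qb: "\<bar>q n\<bar> * (1/3)^n \<le> (1/3)^n" for n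
    using p[of n] q[of n] by auto
  have sp: "summable (\<lambda>n. p n * (1/3)^n)"
    by (rule summable_comparison_test[OF _ geo]) (use pb in \<open>auto simp: abs_mult\<close>)
  have sq: "summable (\<lambda>n. q n * (1/3)^n)"
    by (rule summable_comparison_test[OF _ geo]) (use qb in \<open>auto simp: abs_mult\<close>)
  have sd: "summable (\<lambda>n. d n * (1/3)^n)"
    using summable_diff[OF sp sq] by (simp add: d_def left_diff_distrib)
  have eq: "(\<Sum>n. p n * (1/3)^n) - (\<Sum>n. q n * (1/3)^n) = (\<Sum>n. d n * (1/3)^n)"
    using suminf_diff[OF sp sq] by (simp add: d_def left_diff_distrib)
  have split: "(\<Sum>n. d n * (1/3)^n)
      = (\<Sum>n. d (n + Suc m) * (1/3)^(n + Suc m)) + (\<Sum>n<Suc m. d n * (1/3)^n)"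
    by (rule suminf_split_initial_segment[OF sd])
  have init: "(\<Sum>n<Suc m. d n * (1/3)^n) = d m * (1/3)^m"
    using before by (simp add: d_def)
  have st: "summable (\<lambda>n. d (n + Suc m) * (1/3)^(n + Suc m))"
    using sd by (rule summable_ignore_initial_segment)
  have sg: "summable (\<lambda>n. (1/3::real)^(n + Suc m))"
    using geo by (rule summable_ignore_initial_segment)
  have bnd: "norm (d (n + Suc m) * (1/3)^(n + Suc m)) \<le> (1/3)^(n + Suc m)" for n
    using mult_right_mono[OF dle[of "n + Suc m"], of "(1/3)^(n+Suc m)"]
    by (simp add: abs_mult)
  have "\<bar>\<Sum>n. d (n + Suc m) * (1/3)^(n + Suc m)\<bar> \<le> (\<Sum>n. (1/3::real)^(n + Suc m))"
    using summable_norm_comparison_test[of "\<lambda>n. d (n + Suc m) * (1/3)^(n + Suc m)"] 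
      norm_suminf_le[OF bnd sg] by simp
  also have "\<dots> = (\<Sum>n. (1/3::real)^n) * (1/3)^(Suc m)"
    using suminf_mult2[OF geo, of "(1/3)^(Suc m)"] by (simp add: power_add)
  also have "\<dots> = (1/3)^m / 2"
    by (subst suminf_geometric) auto
  finally have tail: "\<bar>\<Sum>n. d (n + Suc m) * (1/3)^(n + Suc m)\<bar> \<le> (1/3)^m / 2" .
  have "\<bar>d m\<bar> = 1" using p[of m] q[of m] m by (auto simp: d_def)
  then have "\<bar>d m * (1/3)^m\<bar> = (1/3)^m" by (simp add: abs_mult)
  then have "(1/3)^m / 2 \<le> \<bar>\<Sum>n. d n * (1/3)^n\<bar>"
    using split init tail by linarith
  moreover have "(1/3::real)^N \<le> (1/3)^m" using m(1) by (intro power_decreasing) auto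
  ultimately show False using close eq by linarith
qed

text \<open>The code lists membership in the balls of countably many finite covers as ternary digits. It is
measurable because the balls are open. It need not be continuous, and in general cannot be; what
matters is that nearby codes force nearby points, since every scale is decided by finitely many
digits.\<close>
lemma compact_metric_real_code:
  assumes comp: "compact (UNIV :: 'a::metric_space set)"
  obtains c :: "'a::metric_space \<Rightarrow> real"
  where "c \<in> borel_measurable borel" "\<And>x. 0 \<le> c x \<and> c x \<le> 3/2"
    "\<And>\<epsilon>. 0 < \<epsilon> \<Longrightarrow> \<exists>\<delta>>0. \<forall>x y. \<bar>c x - c y\<bar> < \<delta> \<longrightarrow> dist x y < \<epsilon>"
proof -
  have "\<exists>D::'a set. finite D \<and> UNIV \<subseteq> (\<Union>d\<in>D. ball d (1 / Suc k))" for k :: nat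
    using comp unfolding compact_eq_totally_bounded by (auto dest!: spec[of _ "1 / Suc k"])
  then obtain D :: "nat \<Rightarrow> 'a set" where D: "\<And>k. finite (D k)"
    "\<And>k. UNIV \<subseteq> (\<Union>d\<in>D k. ball d (1 / Suc k))" by metis
  define \<B> where "\<B> = (\<Union>k. (\<lambda>d. ball d (1 / Suc k)) ` D k)"
  have cB: "countable \<B>" unfolding \<B>_def using D(1) by (intro countable_UN) (auto intro: countable_finite)
  have neB: "\<B> \<noteq> {}" using D(2)[of 0] unfolding \<B>_def by fastforce
  define B where "B = from_nat_into \<B>"
  have openB: "open (B n)" for n
    using from_nat_into[OF neB, of n] unfolding B_def \<B>_def by auto
  have surjB: "\<exists>n. B n = U" if "U \<in> \<B>" for U
    using from_nat_into_surj[OF cB that] by (auto simp: B_def)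
  define a where "a x n = (indicator (B n) x :: real)" for x n
  define c where "c x = (\<Sum>n. a x n * (1/3)^n)" for x
  have a01: "a x n = 0 \<or> a x n = 1" for x n by (auto simp: a_def indicator_def)
  have geo: "summable (\<lambda>n. (1/3::real)^n)" by (intro summable_geometric) auto
  have bnd: "0 \<le> a x n * (1/3)^n \<and> a x n * (1/3)^n \<le> (1/3)^n" for x n
    using a01[of x n] by auto
  have sa: "summable (\<lambda>n. a x n * (1/3)^n)" for x
    by (rule summable_comparison_test[OF _ geo]) (use bnd in auto)
  show thesis
  proof
    show "c \<in> borel_measurable borel"
      unfolding c_def a_def using openB by (intro borel_measurable_suminf) auto
    show "0 \<le> c x \<and> c x \<le> 3/2" for x
    proof
      show "0 \<le> c x" unfolding c_def using bnd by (intro suminf_nonneg sa) auto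
      have "c x \<le> (\<Sum>n. (1/3::real)^n)"
        unfolding c_def using bnd by (intro suminf_le sa geo) auto
      also have "\<dots> = 3/2" by (subst suminf_geometric) auto
      finally show "c x \<le> 3/2" .
    qed
    fix \<epsilon> :: real assume "0 < \<epsilon>"
    then obtain k :: nat where k: "2 / Suc k < \<epsilon>"
      using reals_Archimedean[of "\<epsilon>/2"] by (auto simp: field_simps)
    have "\<exists>N. \<forall>d\<in>D k. \<exists>n\<le>N. B n = ball d (1 / Suc k)"
    proof -
      have "\<forall>d\<in>D k. \<exists>n. B n = ball d (1 / Suc k)"
        using surjB by (auto simp: \<B>_def)
      then obtain g where g: "\<And>d. d \<in> D k \<Longrightarrow> B (g d) = ball d (1 / Suc k)" by metis
      have "\<forall>d\<in>D k. g d \<le> Max (g ` D k)" using D(1) by auto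
      then show ?thesis using g by blast
    qed
    then obtain N where N: "\<And>d. d \<in> D k \<Longrightarrow> \<exists>n\<le>N. B n = ball d (1 / Suc k)" by blast
    show "\<exists>\<delta>>0. \<forall>x y. \<bar>c x - c y\<bar> < \<delta> \<longrightarrow> dist x y < \<epsilon>"
    proof (intro exI[of _ "(1/3)^N / 2"] conjI allI impI)
      fix x y assume "\<bar>c x - c y\<bar> < (1/3)^N / 2"
      then have same: "\<forall>n\<le>N. a x n = a y n"
        unfolding c_def by (intro ternary_first_difference a01) auto
      obtain d where d: "d \<in> D k" "x \<in> ball d (1 / Suc k)" using D(2)[of k] by blast
      obtain n where n: "n \<le> N" "B n = ball d (1 / Suc k)" using N[OF d(1)] by blast
      have "a x n = 1" using d n by (simp add: a_def)
      then have "y \<in> ball d (1 / Suc k)"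
        using same n by (auto simp: a_def indicator_def split: if_splits)
      then have "dist x y < 1 / Suc k + 1 / Suc k"
        using d(2) by (intro dist_triangle_less_add[of x d]) (auto simp: dist_commute)
      then show "dist x y < \<epsilon>" using k by simp
    qed auto
  qed
qed

text \<open>The closure of the graph is compact and projects injectively to the code axis, so the
projection is a homeomorphism and its inverse followed by the second projection decodes. Working with the
graph avoids extending a map into a space that is complete only by compactness.\<close>
lemma continuous_left_inverse_on_closure:
  fixes c :: "'a::metric_space \<Rightarrow> real"
  assumes comp: "compact (UNIV :: 'a set)"
    and bounded: "\<And>x. 0 \<le> c x \<and> c x \<le> R"
    and inverse: "\<And>\<epsilon>. 0 < \<epsilon> \<Longrightarrow> \<exists>\<delta>>0. \<forall>x y. \<bar>c x - c y\<bar> < \<delta> \<longrightarrow> dist x y < \<epsilon>"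
  obtains p where "continuous_on (closure (range c)) p" "\<And>x. p (c x) = x"
proof -
  define G where "G = closure (range (\<lambda>x. (c x, x)))"
  have sub: "range (\<lambda>x. (c x, x)) \<subseteq> {0..R} \<times> UNIV" using bounded by auto
  have compR: "compact ({0..R} \<times> (UNIV :: 'a set))" using comp by (intro compact_Times) auto
  have Gsub: "G \<subseteq> {0..R} \<times> UNIV"
    unfolding G_def by (rule closure_minimal[OF sub compact_imp_closed[OF compR]])
  have compG: "compact G"
    using compact_Int_closed[OF compR, of G] Gsub by (simp add: G_def Int_absorb1)
  have uniq: "x = x'" if "(t, x) \<in> G" "(t, x') \<in> G" for t x x'
  proof -
    have "dist x x' \<le> 0 + e" if e: "0 < e" for e
    proof -
      obtain \<delta> where \<delta>: "\<delta> > 0" "\<And>x y. \<bar>c x - c y\<bar> < \<delta> \<Longrightarrow> dist x y < e/3"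
        using inverse[of "e/3"] e by auto
      define r where "r = min (\<delta>/2) (e/3)"
      have r: "r > 0" using \<delta> e by (auto simp: r_def)
      have near: "\<exists>y. \<bar>c y - t\<bar> < r \<and> dist y w < r" if "(t, w) \<in> G" for w
      proof -
        have "\<exists>z\<in>range (\<lambda>x. (c x, x)). dist z (t, w) < r"
          using that r unfolding G_def closure_approachable by blast
        then obtain y where "dist (c y, y) (t, w) < r" by blast
        then show ?thesis
          using dist_fst_le[of "(c y, y)" "(t, w)"] dist_snd_le[of "(c y, y)" "(t, w)"]
          by (auto simp: dist_real_def intro!: exI[of _ y])
      qed
      obtain y y' where y: "\<bar>c y - t\<bar> < r" "dist y x < r" "\<bar>c y' - t\<bar> < r" "dist y' x' < r"
        using near[OF \<open>(t, x) \<in> G\<close>] near[OF \<open>(t, x') \<in> G\<close>] by auto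
      have "\<bar>c y - c y'\<bar> < \<delta>" using y(1,3) unfolding r_def by linarith
      then have "dist y y' < e/3" by (rule \<delta>)
      then show ?thesis
        using y dist_triangle[of x x' y] dist_triangle[of y x' y'] by (simp add: r_def dist_commute)
    qed
    then show ?thesis using field_le_epsilon[of "dist x x'" 0] by simp
  qed
  (* single-valuedness of the closed graph is the uniform continuity of the inverse code *)
  have inj: "inj_on fst G" using uniq by (auto simp: inj_on_def)
  have img: "fst ` G = closure (range c)"
  proof
    have "fst ` G \<subseteq> closure (fst ` range (\<lambda>x. (c x, x)))"
      unfolding G_def by (intro image_closure_subset continuous_on_fst continuous_on_id) (auto intro: closure_subset[THEN subsetD])
    then show "fst ` G \<subseteq> closure (range c)" by (simp add: image_image)
    have "closed (fst ` G)"
      using compG by (intro compact_imp_closed compact_continuous_image continuous_on_fst continuous_on_id)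
    moreover have "range c \<subseteq> fst ` G"
    proof
      fix t assume "t \<in> range c"
      then obtain x where "t = c x" by auto
      moreover have "(c x, x) \<in> G" unfolding G_def by (rule closure_subset[THEN subsetD]) auto
      ultimately show "t \<in> fst ` G" by force
    qed
    ultimately show "closure (range c) \<subseteq> fst ` G" by (intro closure_minimal)
  qed
  obtain g where g: "homeomorphism G (closure (range c)) fst g"
    using homeomorphism_compact[OF compG _ img inj] continuous_on_fst[OF continuous_on_id] by blast
  show thesis
  proof
    show "continuous_on (closure (range c)) (\<lambda>t. snd (g t))"
      using g by (intro continuous_on_snd) (simp add: homeomorphism_def)
    fix x
    have "(c x, x) \<in> G" unfolding G_def by (rule closure_subset[THEN subsetD]) auto
    then have "g (fst (c x, x)) = (c x, x)" using g unfolding homeomorphism_def by blast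
    then show "snd (g (c x)) = x" by simp
  qed
qed

lemma compact_UNIV_continuous_bounded:
  fixes f :: "'a::metric_space \<Rightarrow> real"
  assumes "compact (UNIV :: 'a set)" "continuous_on UNIV f"
  obtains R where "0 < R" "\<And>x. \<bar>f x\<bar> \<le> R"
proof -
  have "bounded (range f)" using assms by (intro compact_imp_bounded compact_continuous_image)
  then obtain R where "\<forall>y\<in>range f. norm y \<le> R" "0 < R" unfolding bounded_pos by blast
  then show thesis using that by auto
qed

text \<open>Weak compactness is transported from the real line. The measures are pushed forward by the
code, Helly's theorem yields a weakly convergent subsequence there, and the limit lives on the closure of the
set of codes, where it can be decoded continuously. Continuous functions on \<open>X\<close> become
continuous functions of the code, extended to the line by Tietze.\<close>
theorem compact_metric_weak_sequential_compactness:
  fixes \<mu> :: "nat \<Rightarrow> 'a::metric_space measure"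
  assumes comp: "compact (UNIV :: 'a set)"
    and prob: "\<And>k. prob_space (\<mu> k)" and sets: "\<And>k. sets (\<mu> k) = sets borel"
  obtains r :: "nat \<Rightarrow> nat" and \<nu> :: "'a measure"
  where "strict_mono r" "prob_space \<nu>" "sets \<nu> = sets borel"
    "\<And>f::'a \<Rightarrow> real. continuous_on UNIV f \<Longrightarrow> (\<lambda>k. integral\<^sup>L (\<mu> (r k)) f) \<longlonglongrightarrow> integral\<^sup>L \<nu> f"
proof -
  obtain c :: "'a \<Rightarrow> real" where c: "c \<in> borel_measurable borel" "\<And>x. 0 \<le> c x \<and> c x \<le> 3/2"
    "\<And>\<epsilon>. 0 < \<epsilon> \<Longrightarrow> \<exists>\<delta>>0. \<forall>x y. \<bar>c x - c y\<bar> < \<delta> \<longrightarrow> dist x y < \<epsilon>"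
    using compact_metric_real_code[OF comp] by blast
  obtain p where p: "continuous_on (closure (range c)) p" "\<And>x. p (c x) = x"
    using continuous_left_inverse_on_closure[OF comp c(2,3)] by blast
  define K where "K = closure (range c)"
  have cK: "c x \<in> K" for x unfolding K_def by (rule closure_subset[THEN subsetD]) auto
  have cm: "c \<in> measurable (\<mu> k) borel" for k
    using c(1) by (simp add: measurable_def sets sets_eq_imp_space_eq[OF sets])
  define M where "M k = distr (\<mu> k) borel c" for k
  have probM: "prob_space (M k)" for k
    unfolding M_def by (rule prob_space.prob_space_distr[OF prob cm])
  have rdM: "real_distribution (M k)" for k
    using probM by (simp add: real_distribution_def real_distribution_axioms_def M_def)
  have "tight M"
    unfolding tight_def
  proof (intro conjI allI impI)
    show "real_distribution (M n)" for n by (rule rdM)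
    fix e :: real assume e: "0 < e"
    have "measure (M n) {-1<..2} = 1" for n
    proof -
      interpret prob_space "M n" by (rule probM)
      have "emeasure (M n) {-1<..2} = emeasure (\<mu> n) (c -` {-1<..2} \<inter> space (\<mu> n))"
        unfolding M_def by (rule emeasure_distr[OF cm]) simp
      also have "c -` {-1<..2} \<inter> space (\<mu> n) = space (\<mu> n)"
      proof -
        have "c x \<in> {-1<..2}" for x using c(2)[of x] by auto
        then show ?thesis by auto
      qed
      also have "emeasure (\<mu> n) (space (\<mu> n)) = 1" by (rule prob_space.emeasure_space_1[OF prob])
      finally show ?thesis by (simp add: measure_def)
    qed
    then show "\<exists>a b. a < b \<and> (\<forall>n. 1 - e < measure (M n) {a<..b})"
      using e by (intro exI[of _ "-1"] exI[of _ 2]) auto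
  qed
  then obtain r N where r: "strict_mono (r :: nat \<Rightarrow> nat)" and N: "real_distribution N"
    and conv: "weak_conv_m (M \<circ> id \<circ> r) N"
    using tight_imp_convergent_subsubsequence[of M id] by (auto simp: strict_mono_id)
  interpret N: real_distribution N by (rule N)
  have setsN: "sets N = sets borel" by simp
  have lim: "(\<lambda>k. \<integral>x. F (c x) \<partial>\<mu> (r k)) \<longlonglongrightarrow> integral\<^sup>L N F"
    if F: "continuous_on UNIV F" "\<And>t. \<bar>F t\<bar> \<le> R" for F :: "real \<Rightarrow> real" and R
  proof -
    have "(\<lambda>k. integral\<^sup>L ((M \<circ> id \<circ> r) k) F) \<longlonglongrightarrow> integral\<^sup>L N F"
      by (rule weak_conv_imp_integral_bdd_continuous_conv[OF _ N conv, where B = R])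
        (use rdM F in \<open>auto simp: continuous_on_eq_continuous_at\<close>)
    moreover have "integral\<^sup>L (M k) F = (\<integral>x. F (c x) \<partial>\<mu> k)" for k
      unfolding M_def by (rule integral_distr[OF cm]) (use F in \<open>auto intro: borel_measurable_continuous_onI\<close>)
    ultimately show ?thesis by simp
  qed
  (* the truncated distance to K vanishes on all codes, hence also in the limit *)
  have AEK: "AE t in N. t \<in> K"
  proof -
    define F where "F t = min 1 (infdist t K)" for t
    have neK: "K \<noteq> {}" using cK by auto
    have Fc: "continuous_on UNIV F" unfolding F_def by (intro continuous_intros)
    have Fb: "\<bar>F t\<bar> \<le> 1" for t by (simp add: F_def infdist_nonneg)
    have "F (c x) = 0" for x using cK by (simp add: F_def)
    then have "integral\<^sup>L N F = 0"
      using lim[OF Fc Fb] LIMSEQ_unique[OF _ tendsto_const] by fastforce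
    moreover have "integrable N F"
      by (rule N.integrable_const_bound[where B = 1]) (use Fb borel_measurable_continuous_onI[OF Fc] in auto)
    ultimately have "AE t in N. F t = 0"
      using integral_nonneg_eq_0_iff_AE[of N F] by (simp add: F_def infdist_nonneg)
    then show ?thesis
    proof (rule AE_mp, intro AE_I2 impI)
      fix t assume "F t = 0"
      then have "infdist t K = 0" by (auto simp: F_def min_def split: if_splits)
      then show "t \<in> K" using neK by (simp add: in_closed_iff_infdist_zero K_def)
    qed
  qed
  define q where "q t = (if t \<in> K then p t else undefined)" for t
  have qm: "q \<in> measurable N borel"
    unfolding q_def using p(1)
    by (subst measurable_cong_sets[OF setsN refl])
      (intro borel_measurable_continuous_on_if, auto simp: K_def)
  define \<nu> where "\<nu> = distr N borel q"
  show thesis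
  proof
    show "strict_mono r" by (rule r)
    show "prob_space \<nu>" unfolding \<nu>_def by (rule N.prob_space_distr[OF qm])
    show "sets \<nu> = sets borel" by (simp add: \<nu>_def)
    fix f :: "'a \<Rightarrow> real" assume f: "continuous_on UNIV f"
    obtain R where R: "0 < R" "\<And>x. \<bar>f x\<bar> \<le> R" using compact_UNIV_continuous_bounded[OF comp f] by blast
    have fm: "f \<in> borel_measurable borel" using f by (rule borel_measurable_continuous_onI)
    have "continuous_on K (\<lambda>t. f (p t))"
      using continuous_on_compose2[OF f p(1)] by (simp add: K_def)
    then obtain F where F: "continuous_on UNIV F" "\<And>t. t \<in> K \<Longrightarrow> F t = f (p t)"
      "\<And>t. norm (F t) \<le> R"
      using Tietze[of K "\<lambda>t. f (p t)" UNIV R] R by (auto simp: K_def)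
    have "integral\<^sup>L \<nu> f = (\<integral>t. f (q t) \<partial>N)" unfolding \<nu>_def by (rule integral_distr[OF qm fm])
    also have "\<dots> = integral\<^sup>L N F"
    proof (rule integral_cong_AE)
      show "(\<lambda>t. f (q t)) \<in> borel_measurable N" using qm fm by measurable
      show "F \<in> borel_measurable N" using borel_measurable_continuous_onI[OF F(1)] by simp
      show "AE t in N. f (q t) = F t" using AEK by eventually_elim (simp add: q_def F)
    qed
    finally have "integral\<^sup>L \<nu> f = integral\<^sup>L N F" .
    moreover have "F (c x) = f x" for x using F(2)[OF cK] by (simp add: p)
    ultimately show "(\<lambda>k. integral\<^sup>L (\<mu> (r k)) f) \<longlonglongrightarrow> integral\<^sup>L \<nu> f"
      using lim[of F R] F by simp
  qed
qed

text \<open>Indicators of open sets are increasing limits of truncated multiples of the distance to the complement.\<close>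
lemma prob_measure_eqI_continuous:
  fixes \<mu> \<nu> :: "'a::metric_space measure"
  assumes prob: "prob_space \<mu>" "prob_space \<nu>"
    and sets: "sets \<mu> = sets borel" "sets \<nu> = sets borel"
    and eq: "\<And>f::'a \<Rightarrow> real. continuous_on UNIV f \<Longrightarrow> (\<And>x. 0 \<le> f x \<and> f x \<le> 1) \<Longrightarrow>
        integral\<^sup>L \<mu> f = integral\<^sup>L \<nu> f"
  shows "\<mu> = \<nu>"
proof (rule measure_eqI_generator_eq[where E = "{U. open U}" and \<Omega> = UNIV and A = "\<lambda>_. UNIV"])
  interpret \<mu>: prob_space \<mu> by (rule prob)
  interpret \<nu>: prob_space \<nu> by (rule prob)
  fix U :: "'a set" assume "U \<in> {U. open U}"
  then have U: "open U" by simp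
  show "emeasure \<mu> U = emeasure \<nu> U"
  proof (cases "U = UNIV")
    case True
    then show ?thesis
      using \<mu>.emeasure_space_1 \<nu>.emeasure_space_1 sets_eq_imp_space_eq[OF sets(1)] sets_eq_imp_space_eq[OF sets(2)] by simp
  next
    case False
    define f where "f n x = min 1 (real n * infdist x (- U))" for n x
    have fc: "continuous_on UNIV (f n)" for n unfolding f_def by (intro continuous_intros)
    have f01: "0 \<le> f n x \<and> f n x \<le> 1" for n x by (simp add: f_def infdist_nonneg)
    have lim: "(\<lambda>n. f n x) \<longlonglongrightarrow> indicator U x" for x
    proof (cases "x \<in> U")
      case True
      then have "infdist x (- U) > 0"
        using False U in_closed_iff_infdist_zero[of "- U" x] infdist_nonneg[of x "- U"]
        by (force simp: less_le)
      then obtain m :: nat where m: "1 < real m * infdist x (- U)"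
        using reals_Archimedean3 by blast
      have "eventually (\<lambda>n. f n x = 1) sequentially"
        using eventually_ge_at_top[of m]
      proof eventually_elim
        case (elim n)
        have "real m * infdist x (- U) \<le> real n * infdist x (- U)"
          using elim by (intro mult_right_mono infdist_nonneg) auto
        then show ?case using m by (simp add: f_def)
      qed
      then show ?thesis using True by (simp add: tendsto_eventually)
    qed (simp add: f_def)
    have I: "(\<lambda>n. integral\<^sup>L M (f n)) \<longlonglongrightarrow> measure M U"
      if "prob_space M" "sets M = sets borel" for M :: "'a measure"
    proof -
      interpret prob_space M by fact
      have fm: "f n \<in> borel_measurable M" for n
        using borel_measurable_continuous_onI[OF fc] by (simp add: measurable_cong_sets[OF that(2) refl])
      have UM: "U \<in> sets M" using U that(2) by simp
      have "(\<lambda>n. integral\<^sup>L M (f n)) \<longlonglongrightarrow> (\<integral>x. indicator U x \<partial>M)"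
        by (rule integral_dominated_convergence[where w = "\<lambda>_. 1"]) (use fm UM lim f01 in auto)
      then show ?thesis using UM sets_eq_imp_space_eq[OF that(2)] by simp
    qed
    have "measure \<mu> U = measure \<nu> U"
      using I[OF prob(1) sets(1)] I[OF prob(2) sets(2)] eq[OF fc f01] LIMSEQ_unique by auto
    then show ?thesis by (simp add: \<mu>.emeasure_eq_measure \<nu>.emeasure_eq_measure)
  qed
next
  interpret \<mu>: prob_space \<mu> by (rule prob)
  show "emeasure \<mu> UNIV \<noteq> \<infinity>" for i :: nat by simp
qed (auto simp: sets borel_def Int_stable_def)

text \<open>Empirical measures of orbit segments are asymptotically invariant because a Birkhoff sum of
\<open>f \<circ> T - f\<close> telescopes. Starting points and lengths may vary with the index, which is
what the pseudo-orbit arguments below require.\<close>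
theorem krylov_bogolyubov:
  fixes T :: "'a::metric_space \<Rightarrow> 'a"
  assumes comp: "compact (UNIV :: 'a set)" and T: "continuous_on UNIV T"
    and n: "filterlim n at_top sequentially"
  obtains r :: "nat \<Rightarrow> nat" and \<mu> where "strict_mono r" "\<mu> \<in> invariant_measures T"
    "\<And>f::'a \<Rightarrow> real. continuous_on UNIV f \<Longrightarrow>
       (\<lambda>k. birkhoff_sum T f (n (r k)) (x (r k)) / n (r k)) \<longlonglongrightarrow> integral\<^sup>L \<mu> f"
proof -
  (* the maximum keeps the index set of the empirical measure nonempty; it is eventually invisible *)
  define N where "N k = max 1 (n k)" for k
  define M where "M k = distr (measure_pmf (pmf_of_set {..<N k})) borel (\<lambda>i. (T ^^ i) (x k))" for k
  have int: "integral\<^sup>L (M k) f = birkhoff_sum T f (N k) (x k) / N k"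
    if "continuous_on UNIV f" for k and f :: "'a \<Rightarrow> real"
  proof -
    have "0 \<in> {..<N k}" by (simp add: N_def)
    then have "{..<N k} \<noteq> {}" by blast
    then show ?thesis
      unfolding M_def using borel_measurable_continuous_onI[OF that]
      by (subst integral_distr) (auto simp: integral_pmf_of_set birkhoff_sum_def)
  qed
  obtain r \<mu> where r: "strict_mono r" and \<mu>: "prob_space \<mu>" "sets \<mu> = sets borel"
    and lim: "\<And>f::'a \<Rightarrow> real. continuous_on UNIV f \<Longrightarrow> (\<lambda>k. integral\<^sup>L (M (r k)) f) \<longlonglongrightarrow> integral\<^sup>L \<mu> f"
    using compact_metric_weak_sequential_compactness[OF comp, of M]
    by (auto simp: M_def measure_pmf.prob_space_distr)
  have nr: "filterlim (\<lambda>k. n (r k)) at_top sequentially"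
    using filterlim_compose[OF n filterlim_subseq[OF r]] by simp
  have ev: "eventually (\<lambda>k. N (r k) = n (r k)) sequentially"
    using filterlim_at_top[THEN iffD1, OF nr, rule_format, of 1]
    by eventually_elim (simp add: N_def)
  have lim2: "(\<lambda>k. birkhoff_sum T f (n (r k)) (x (r k)) / n (r k)) \<longlonglongrightarrow> integral\<^sup>L \<mu> f"
    if f: "continuous_on UNIV f" for f :: "'a \<Rightarrow> real"
    using lim[OF f] by (rule Lim_transform_eventually) (use ev int[OF f] in \<open>auto elim: eventually_mono\<close>)
  have Tm: "T \<in> measurable \<mu> borel"
    using borel_measurable_continuous_onI[OF T] by (simp add: measurable_cong_sets[OF \<mu>(2) refl])
  have "distr \<mu> borel T = \<mu>"
  proof (rule prob_measure_eqI_continuous)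
    show "prob_space (distr \<mu> borel T)" by (rule prob_space.prob_space_distr[OF \<mu>(1) Tm])
    fix f :: "'a \<Rightarrow> real" assume f: "continuous_on UNIV f" and f01: "\<And>x. 0 \<le> f x \<and> f x \<le> 1"
    have fT: "continuous_on UNIV (\<lambda>x. f (T x))" using continuous_on_compose2[OF f T] by simp
    have "(\<lambda>k. birkhoff_sum T (\<lambda>x. f (T x)) (n (r k)) (x (r k)) / n (r k)
              - birkhoff_sum T f (n (r k)) (x (r k)) / n (r k)) \<longlonglongrightarrow> 0"
    proof (rule Lim_null_comparison)
      have "norm (birkhoff_sum T (\<lambda>x. f (T x)) m y / m - birkhoff_sum T f m y / m) \<le> 1 / m"
        for m :: nat and y
      proof -
        have "birkhoff_sum T (\<lambda>x. f (T x)) m y - birkhoff_sum T f m y = f ((T ^^ m) y) - f y"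
          unfolding birkhoff_sum_def sum_subtractf[symmetric]
          using sum_lessThan_telescope[of "\<lambda>i. f ((T ^^ i) y)" m] by simp
        moreover have "\<bar>f ((T ^^ m) y) - f y\<bar> \<le> 1" using f01[of y] f01[of "(T ^^ m) y"] by auto
        ultimately show ?thesis
          by (auto simp: diff_divide_distrib[symmetric] intro: divide_right_mono)
      qed
      then show "\<forall>\<^sub>F k in sequentially. norm (birkhoff_sum T (\<lambda>x. f (T x)) (n (r k)) (x (r k)) / n (r k)
              - birkhoff_sum T f (n (r k)) (x (r k)) / n (r k)) \<le> 1 / real (n (r k))"
        by simp
      show "(\<lambda>k. 1 / real (n (r k))) \<longlonglongrightarrow> 0"
        using filterlim_compose[OF filterlim_real_sequentially nr]
        by (intro tendsto_divide_0[OF tendsto_const] filterlim_at_top_imp_at_infinity)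
    qed
    then have "(\<integral>x. f (T x) \<partial>\<mu>) - integral\<^sup>L \<mu> f = 0"
      using LIMSEQ_unique tendsto_diff[OF lim2[OF fT] lim2[OF f]] by blast
    moreover have "integral\<^sup>L (distr \<mu> borel T) f = (\<integral>x. f (T x) \<partial>\<mu>)"
      by (rule integral_distr[OF Tm borel_measurable_continuous_onI[OF f]])
    ultimately show "integral\<^sup>L (distr \<mu> borel T) f = integral\<^sup>L \<mu> f" by simp
  qed (use \<mu> in auto)
  then have "\<mu> \<in> invariant_measures T" using \<mu> by (simp add: invariant_measures_def)
  then show thesis using that r lim2 by blast
qed

section \<open>Pulling back orbits of an open expanding map\<close>

text \<open>Openness at a single point gives a radius that still works nearby; compactness makes it uniform.\<close>
lemma open_map_uniform_ball:
  fixes T :: "'a::metric_space \<Rightarrow> 'a"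
  assumes comp: "compact (UNIV :: 'a set)" and T: "continuous_on UNIV T"
    and op: "open_map euclidean euclidean T" and h: "0 < h"
  obtains r where "0 < r" "\<And>x. ball (T x) r \<subseteq> T ` ball x h"
proof -
  have "\<exists>d r. 0 < d \<and> 0 < r \<and> (\<forall>x\<in>ball z d. ball (T x) r \<subseteq> T ` ball x h)" for z
  proof -
    have "open (T ` ball z (h/2))" using op by (auto simp: open_map_def)
    moreover have "T z \<in> T ` ball z (h/2)" using h by auto
    ultimately obtain r where r: "0 < r" "ball (T z) r \<subseteq> T ` ball z (h/2)"
      by (meson openE)
    obtain d where d: "0 < d" "\<And>x. dist x z < d \<Longrightarrow> dist (T x) (T z) < r/2"
      using T r(1) unfolding continuous_on_iff by (metis UNIV_I half_gt_zero)
    show ?thesis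
    proof (rule exI[of _ "min d (h/2)"], rule exI[of _ "r/2"], intro conjI ballI)
      fix x assume x: "x \<in> ball z (min d (h/2))"
      have "ball (T x) (r/2) \<subseteq> ball (T z) r"
      proof
        fix y assume "y \<in> ball (T x) (r/2)"
        then show "y \<in> ball (T z) r"
          using d(2)[of x] x dist_triangle[of "T z" y "T x"] by (simp add: dist_commute)
      qed
      also have "\<dots> \<subseteq> T ` ball z (h/2)" by (rule r)
      also have "\<dots> \<subseteq> T ` ball x h"
      proof (intro image_mono subsetI)
        fix y assume "y \<in> ball z (h/2)"
        then show "y \<in> ball x h"
          using x dist_triangle[of x y z] by (simp add: dist_commute)
      qed
      finally show "ball (T x) (r/2) \<subseteq> T ` ball x h" .
    qed (use d r h in auto)
  qed
  then obtain d r where dr: "\<And>z. 0 < d z" "\<And>z. 0 < r z"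
    "\<And>z x. x \<in> ball z (d z) \<Longrightarrow> ball (T x) (r z) \<subseteq> T ` ball x h" by metis
  have cover: "UNIV \<subseteq> (\<Union>z. ball z (d z))" using dr(1) by fastforce
  obtain F where F: "finite F" "UNIV \<subseteq> (\<Union>z\<in>F. ball z (d z))"
    by (rule compactE_image[OF comp, of UNIV "\<lambda>z. ball z (d z)"]) (use cover in auto)
  have Fne: "F \<noteq> {}" using F(2) by auto
  show thesis
  proof
    show "0 < Min (r ` F)" using F(1) Fne dr(2) by simp
    fix x
    obtain z where z: "z \<in> F" "x \<in> ball z (d z)" using F(2) by blast
    have "ball (T x) (Min (r ` F)) \<subseteq> ball (T x) (r z)"
      using F(1) z by (intro subset_ball) simp
    then show "ball (T x) (Min (r ` F)) \<subseteq> T ` ball x h" using dr(3)[OF z(2)] by blast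
  qed
qed

text \<open>Openness supplies a preimage within the scale of expansivity, and expansion then bounds its distance.\<close>
lemma contracting_inverse_branch:
  fixes T :: "'a::metric_space \<Rightarrow> 'a"
  assumes comp: "compact (UNIV :: 'a set)" and T: "continuous_on UNIV T"
    and op: "open_map euclidean euclidean T" and ex: "distance_expanding T"
  obtains s \<rho> where "0 < s" "s < 1" "0 < \<rho>"
    "\<And>x y. dist (T x) y \<le> \<rho> \<Longrightarrow> \<exists>x'. T x' = y \<and> dist x x' \<le> s * dist (T x) y"
proof -
  obtain r h where r: "1 < r" "0 < h"
    "\<And>x y. dist x y \<le> 2 * h \<Longrightarrow> r * dist x y \<le> dist (T x) (T y)"
    using ex unfolding distance_expanding_def by auto
  obtain e where e: "0 < e" "\<And>x. ball (T x) e \<subseteq> T ` ball x h"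
    using open_map_uniform_ball[OF comp T op r(2)] by blast
  show thesis
  proof (rule that[of "1/r" "e/2"])
    fix x y assume "dist (T x) y \<le> e/2"
    then have "y \<in> ball (T x) e" using e(1) by simp
    then obtain x' where x': "T x' = y" "dist x x' < h" using e(2) by fastforce
    then have "r * dist x x' \<le> dist (T x) y" using r by force
    then show "\<exists>x'. T x' = y \<and> dist x x' \<le> 1/r * dist (T x) y"
      using x' r(1) by (auto simp: field_simps)
  qed (use r e in auto)
qed

lemma iterated_inverse_branch:
  fixes T :: "'a::metric_space \<Rightarrow> 'a"
  assumes s: "0 < s" "s < 1"
    and branch: "\<And>x y. dist (T x) y \<le> \<rho> \<Longrightarrow> \<exists>x'. T x' = y \<and> dist x x' \<le> s * dist (T x) y"
    and close: "dist ((T ^^ n) x) y \<le> \<rho>"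
  shows "\<exists>x'. (T ^^ n) x' = y \<and>
    (\<forall>i\<le>n. dist ((T ^^ i) x) ((T ^^ i) x') \<le> s ^ (n - i) * dist ((T ^^ n) x) y)"
  using close
proof (induction n arbitrary: y)
  case (0 y)
  show ?case
    by (rule exI[of _ y]) simp
next
  case (Suc n y)
  obtain w where w: "T w = y" "dist ((T ^^ n) x) w \<le> s * dist ((T ^^ Suc n) x) y"
    using branch[of "(T ^^ n) x" y] Suc.prems by auto
  have "s * dist ((T ^^ Suc n) x) y \<le> 1 * dist ((T ^^ Suc n) x) y"
    using s by (intro mult_right_mono) auto
  then have "dist ((T ^^ n) x) w \<le> \<rho>" using w Suc.prems by linarith
  from Suc.IH[OF this] obtain x' where x': "(T ^^ n) x' = w"
    "\<And>i. i \<le> n \<Longrightarrow> dist ((T ^^ i) x) ((T ^^ i) x') \<le> s ^ (n - i) * dist ((T ^^ n) x) w" by blast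
  have end': "(T ^^ Suc n) x' = y" using x' w by simp
  have "dist ((T ^^ i) x) ((T ^^ i) x') \<le> s ^ (Suc n - i) * dist ((T ^^ Suc n) x) y"
    if "i \<le> Suc n" for i
  proof (cases "i = Suc n")
    case True
    then show ?thesis using end' by simp
  next
    case False
    then have i: "i \<le> n" using that by simp
    have "s ^ (n - i) * dist ((T ^^ n) x) w \<le> s ^ (n - i) * (s * dist ((T ^^ Suc n) x) y)"
      using s w by (intro mult_left_mono) auto
    then show ?thesis
      using x'(2)[OF i] i by (simp add: Suc_diff_le mult.assoc mult.left_commute)
  qed
  then show ?case using end' by blast
qed

text \<open>When two orbits approach each other backwards in time at a geometric rate, the Hoelder errors form a geometric series,
so the bound does not depend on the length of the orbit.\<close>
lemma birkhoff_sum_distortion: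
  assumes s: "0 < s" "s < 1" and \<alpha>: "0 < \<alpha>" and C: "0 \<le> C"
    and hoelder: "\<And>x y. \<bar>A x - A y\<bar> \<le> C * dist x y powr \<alpha>"
    and shadow: "\<And>i. i < n \<Longrightarrow> dist ((T ^^ i) x) ((T ^^ i) x') \<le> s ^ (n - i) * D"
    and D: "0 \<le> D"
  shows "\<bar>birkhoff_sum T A n x - birkhoff_sum T A n x'\<bar> \<le> C / (1 - s powr \<alpha>) * D powr \<alpha>"
proof -
  define t where "t = s powr \<alpha>"
  have t: "0 < t" "t < 1" using s \<alpha> powr_less_mono2[of \<alpha> s 1] by (auto simp: t_def)
  have pw: "(s ^ k) powr \<alpha> = t ^ k" for k
    using s by (induction k) (simp_all add: t_def powr_mult)
  have "\<bar>birkhoff_sum T A n x - birkhoff_sum T A n x'\<bar>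
      \<le> (\<Sum>i<n. \<bar>A ((T ^^ i) x) - A ((T ^^ i) x')\<bar>)"
    unfolding birkhoff_sum_def sum_subtractf[symmetric] by (rule sum_abs)
  also have "\<dots> \<le> (\<Sum>i<n. (C * D powr \<alpha>) * t ^ (n - i))"
  proof (rule sum_mono)
    fix i assume "i \<in> {..<n}"
    then have "dist ((T ^^ i) x) ((T ^^ i) x') powr \<alpha> \<le> (s ^ (n - i) * D) powr \<alpha>"
      using shadow \<alpha> by (intro powr_mono2) auto
    also have "\<dots> = t ^ (n - i) * D powr \<alpha>"
      using s D by (simp add: powr_mult pw)
    finally have "C * dist ((T ^^ i) x) ((T ^^ i) x') powr \<alpha> \<le> C * (t ^ (n - i) * D powr \<alpha>)"
      using C by (rule mult_left_mono)
    then show "\<bar>A ((T ^^ i) x) - A ((T ^^ i) x')\<bar> \<le> (C * D powr \<alpha>) * t ^ (n - i)"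
      using hoelder[of "(T ^^ i) x" "(T ^^ i) x'"] by (simp add: mult_ac)
  qed
  also have "\<dots> = (C * D powr \<alpha>) * (\<Sum>i<n. t ^ (n - i))" by (simp add: sum_distrib_left)
  also have "\<dots> \<le> (C * D powr \<alpha>) * (1 / (1 - t))"
  proof (rule mult_left_mono)
    have "(\<Sum>i<n. t ^ (n - i)) = (\<Sum>i<n. t ^ Suc i)"
      by (subst sum.nat_diff_reindex[symmetric], rule sum.cong) (simp_all add: Suc_diff_Suc del: power_Suc)
    also have "\<dots> \<le> (\<Sum>i<n. t ^ i)"
      using t by (intro sum_mono) (simp add: mult_left_le_one_le)
    also have "\<dots> \<le> (\<Sum>i. t ^ i)"
      using t by (intro sum_le_suminf summable_geometric) auto
    also have "\<dots> = 1 / (1 - t)" using t by (intro suminf_geometric) auto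
    finally show "(\<Sum>i<n. t ^ (n - i)) \<le> 1 / (1 - t)" .
  qed (use C in auto)
  finally show ?thesis by (simp add: t_def)
qed

text \<open>Expansion, openness and Hoelder regularity combined: the endpoint of an orbit segment may be moved a little at a cost in the Birkhoff sum that depends on
the displacement alone.\<close>
theorem expanding_pullback:
  fixes T :: "'a::metric_space \<Rightarrow> 'a"
  assumes comp: "compact (UNIV :: 'a set)" and T: "continuous_on UNIV T"
    and op: "open_map euclidean euclidean T" and ex: "distance_expanding T"
    and \<alpha>: "0 < \<alpha>" and A: "holder_continuous \<alpha> A"
  obtains s \<rho> K where "0 < s" "s < 1" "0 < \<rho>" "0 \<le> K"
    "\<And>n x y. dist ((T ^^ n) x) y \<le> \<rho> \<Longrightarrow> \<exists>x'. (T ^^ n) x' = y \<and>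
        dist x x' \<le> s ^ n * dist ((T ^^ n) x) y \<and>
        \<bar>birkhoff_sum T A n x - birkhoff_sum T A n x'\<bar> \<le> K * dist ((T ^^ n) x) y powr \<alpha>"
proof -
  obtain s \<rho> where s: "0 < s" "s < 1" "0 < \<rho>"
    and branch: "\<And>x y. dist (T x) y \<le> \<rho> \<Longrightarrow> \<exists>x'. T x' = y \<and> dist x x' \<le> s * dist (T x) y"
    using contracting_inverse_branch[OF comp T op ex] by blast
  obtain C where C: "\<And>x y. \<bar>A x - A y\<bar> \<le> C * dist x y powr \<alpha>"
    using A unfolding holder_continuous_def by blast
  have C': "\<bar>A x - A y\<bar> \<le> \<bar>C\<bar> * dist x y powr \<alpha>" for x y
    by (rule order_trans[OF C]) (intro mult_right_mono, auto)
  show thesis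
  proof (rule that[of s \<rho> "\<bar>C\<bar> / (1 - s powr \<alpha>)"])
    show "0 \<le> \<bar>C\<bar> / (1 - s powr \<alpha>)" using powr_less_mono2[of \<alpha> s 1] s \<alpha> by simp
    fix n x y assume close: "dist ((T ^^ n) x) y \<le> \<rho>"
    obtain x' where x': "(T ^^ n) x' = y"
      "\<And>i. i \<le> n \<Longrightarrow> dist ((T ^^ i) x) ((T ^^ i) x') \<le> s ^ (n - i) * dist ((T ^^ n) x) y"
      using iterated_inverse_branch[OF s(1,2) branch close] by blast
    have "\<bar>birkhoff_sum T A n x - birkhoff_sum T A n x'\<bar>
        \<le> \<bar>C\<bar> / (1 - s powr \<alpha>) * dist ((T ^^ n) x) y powr \<alpha>"
      by (rule birkhoff_sum_distortion[OF s(1,2) \<alpha> _ C']) (use x' in auto)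
    then show "\<exists>x'. (T ^^ n) x' = y \<and> dist x x' \<le> s ^ n * dist ((T ^^ n) x) y \<and>
        \<bar>birkhoff_sum T A n x - birkhoff_sum T A n x'\<bar>
          \<le> \<bar>C\<bar> / (1 - s powr \<alpha>) * dist ((T ^^ n) x) y powr \<alpha>"
      using x'(1) x'(2)[of 0] by auto
  qed (use s in auto)
qed

lemma holder_continuous_imp_continuous:
  fixes A :: "'a::metric_space \<Rightarrow> real"
  assumes \<alpha>: "0 < \<alpha>" and A: "holder_continuous \<alpha> A"
  shows "continuous_on UNIV A"
  unfolding continuous_on_def
proof
  fix x :: 'a
  obtain C where C: "\<forall>x y. \<bar>A x - A y\<bar> \<le> C * dist x y powr \<alpha>"
    using A unfolding holder_continuous_def by (rule exE)
  have d: "((\<lambda>y. dist y x) \<longlongrightarrow> 0) (at x)"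
    by (rule tendsto_dist_iff[THEN iffD1, OF tendsto_ident_at])
  have "((\<lambda>y. dist y x powr \<alpha>) \<longlongrightarrow> 0) (at x)"
    by (rule tendsto_zero_powrI[OF d tendsto_const]) (simp_all add: \<alpha>)
  then have lim: "((\<lambda>y. C * dist y x powr \<alpha>) \<longlongrightarrow> 0) (at x)"
    by (rule tendsto_mult_right_zero)
  have "\<forall>\<^sub>F y in at x. norm (A y - A x) \<le> C * dist y x powr \<alpha>"
    unfolding real_norm_def by (rule always_eventually) (rule allI, rule C[rule_format])
  then have "((\<lambda>y. A y - A x) \<longlongrightarrow> 0) (at x)"
    using lim by (rule Lim_null_comparison)
  then show "(A \<longlongrightarrow> A x) (at x)" by (rule LIM_zero_cancel)
qed

section \<open>Maximal energy and growth of Birkhoff sums\<close>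

lemma invariant_measure_integrable:
  fixes f :: "'a::metric_space \<Rightarrow> real"
  assumes comp: "compact (UNIV :: 'a set)" and \<mu>: "\<mu> \<in> invariant_measures T"
    and f: "continuous_on UNIV f"
  shows "integrable \<mu> f"
proof -
  have p: "prob_space \<mu>" and sets: "sets \<mu> = sets borel" using \<mu> by (auto simp: invariant_measures_def)
  interpret prob_space \<mu> by (rule p)
  obtain R where "0 < R" "\<And>x. \<bar>f x\<bar> \<le> R" using compact_UNIV_continuous_bounded[OF comp f] by blast
  then show ?thesis
    using borel_measurable_continuous_onI[OF f]
    by (intro integrable_const_bound[where B = R]) (auto simp: measurable_cong_sets[OF sets refl])
qed

lemma continuous_on_funpow:
  fixes T :: "'a::topological_space \<Rightarrow> 'a"
  assumes "continuous_on UNIV T"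
  shows "continuous_on UNIV (T ^^ n)"
proof (induction n)
  case 0
  then show ?case by (simp add: id_def)
next
  case (Suc n)
  then show ?case using continuous_on_compose2[OF assms Suc] by (simp add: comp_def)
qed

lemma birkhoff_sum_add:
  "birkhoff_sum T f (m + n) x = birkhoff_sum T f m x + birkhoff_sum T f n ((T ^^ m) x)"
proof (induction n)
  case (Suc n)
  have "(T ^^ (m + n)) x = (T ^^ n) ((T ^^ m) x)" by (simp add: add.commute[of m] funpow_add)
  then show ?case using Suc by (simp add: birkhoff_sum_def)
qed (simp add: birkhoff_sum_def)

lemma birkhoff_sum_Suc_left:
  "birkhoff_sum T f (Suc n) x = f x + birkhoff_sum T f n (T x)"
  using birkhoff_sum_add[of T f 1 n x] by (simp add: birkhoff_sum_def)

lemma birkhoff_sum_0 [simp]: "birkhoff_sum T f 0 x = 0"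
  by (simp add: birkhoff_sum_def)

lemma birkhoff_sum_1 [simp]: "birkhoff_sum T f (Suc 0) x = f x"
  by (simp add: birkhoff_sum_def)

lemma birkhoff_sum_normalized:
  "birkhoff_sum T (normalized T A) n x = birkhoff_sum T A n x - n * maximal_energy T A"
  by (simp add: birkhoff_sum_def normalized_def sum_subtractf)

lemma integral_birkhoff_sum:
  fixes f :: "'a::metric_space \<Rightarrow> real"
  assumes comp: "compact (UNIV :: 'a set)" and T: "continuous_on UNIV T"
    and \<mu>: "\<mu> \<in> invariant_measures T" and f: "continuous_on UNIV f"
  shows "(\<integral>x. birkhoff_sum T f n x \<partial>\<mu>) = n * integral\<^sup>L \<mu> f"
proof -
  have sets: "sets \<mu> = sets borel" and inv: "distr \<mu> borel T = \<mu>"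
    using \<mu> by (auto simp: invariant_measures_def)
  have Tm: "T \<in> measurable \<mu> borel"
    using borel_measurable_continuous_onI[OF T] by (simp add: measurable_cong_sets[OF sets refl])
  have fT: "continuous_on UNIV (\<lambda>x. f ((T ^^ i) x))" for i
    using continuous_on_compose2[OF f continuous_on_funpow[OF T]] by simp
  have one: "(\<integral>x. g (T x) \<partial>\<mu>) = integral\<^sup>L \<mu> g" if "continuous_on UNIV g" for g :: "'a \<Rightarrow> real"
    using integral_distr[OF Tm borel_measurable_continuous_onI[OF that]] by (simp add: inv)
  have "(\<integral>x. f ((T ^^ i) x) \<partial>\<mu>) = integral\<^sup>L \<mu> f" for i
  proof (induction i)
    case (Suc i)
    have "(\<integral>x. f ((T ^^ Suc i) x) \<partial>\<mu>) = (\<integral>x. f ((T ^^ i) (T x)) \<partial>\<mu>)"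
      by (simp add: funpow_swap1)
    also have "\<dots> = (\<integral>x. f ((T ^^ i) x) \<partial>\<mu>)" by (rule one[OF fT])
    finally show ?case using Suc by simp
  qed simp
  moreover have "integrable \<mu> (\<lambda>x. f ((T ^^ i) x))" for i
    by (rule invariant_measure_integrable[OF comp \<mu> fT])
  ultimately show ?thesis by (simp add: birkhoff_sum_def Bochner_Integration.integral_sum)
qed

lemma invariant_measure_exists:
  fixes T :: "'a::metric_space \<Rightarrow> 'a"
  assumes comp: "compact (UNIV :: 'a set)" and T: "continuous_on UNIV T"
  shows "invariant_measures T \<noteq> {}"
  by (rule krylov_bogolyubov[OF comp T filterlim_ident]) auto

lemma integral_le_maximal_energy:
  fixes A :: "'a::metric_space \<Rightarrow> real"
  assumes comp: "compact (UNIV :: 'a set)" and A: "continuous_on UNIV A"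
    and \<mu>: "\<mu> \<in> invariant_measures T"
  shows "integral\<^sup>L \<mu> A \<le> maximal_energy T A"
  unfolding maximal_energy_def
proof (rule cSUP_upper[OF \<mu>])
  obtain R where R: "\<And>x. \<bar>A x\<bar> \<le> R" using compact_UNIV_continuous_bounded[OF comp A] by blast
  show "bdd_above ((\<lambda>\<mu>. integral\<^sup>L \<mu> A) ` invariant_measures T)"
  proof (intro bdd_aboveI2[where M = R])
    fix \<nu> assume \<nu>: "\<nu> \<in> invariant_measures T"
    then interpret prob_space \<nu> by (simp add: invariant_measures_def)
    show "integral\<^sup>L \<nu> A \<le> R"
      using R abs_le_D1 by (intro integral_le_const invariant_measure_integrable[OF comp \<nu> A]) auto
  qed
qed

text \<open>Integrating against an invariant measure multiplies the energy by \<open>n\<close>, which absorbs the constant \<open>C\<close>.\<close>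
lemma maximal_energy_le_if_birkhoff_sums_le:
  fixes A :: "'a::metric_space \<Rightarrow> real" and \<kappa> C :: real
  assumes comp: "compact (UNIV :: 'a set)" and T: "continuous_on UNIV T"
    and A: "continuous_on UNIV A"
    and le: "\<And>n x. birkhoff_sum T A n x \<le> n * \<kappa> + C"
  shows "maximal_energy T A \<le> \<kappa>"
  unfolding maximal_energy_def
proof (rule cSUP_least[OF invariant_measure_exists[OF comp T]])
  fix \<mu> assume \<mu>: "\<mu> \<in> invariant_measures T"
  then interpret prob_space \<mu> by (simp add: invariant_measures_def)
  have Sc: "continuous_on UNIV (birkhoff_sum T A n)" for n
    unfolding birkhoff_sum_def
    by (intro continuous_on_sum continuous_on_compose2[OF A continuous_on_funpow[OF T]]) auto
  have bound: "n * (integral\<^sup>L \<mu> A - \<kappa>) \<le> C" for n :: nat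
  proof -
    have "(\<integral>x. birkhoff_sum T A n x \<partial>\<mu>) \<le> n * \<kappa> + C"
      using le by (intro integral_le_const invariant_measure_integrable[OF comp \<mu> Sc]) auto
    then show ?thesis
      by (simp add: integral_birkhoff_sum[OF comp T \<mu> A] right_diff_distrib)
  qed
  show "integral\<^sup>L \<mu> A \<le> \<kappa>"
  proof (rule ccontr)
    assume "\<not> ?thesis"
    then obtain n :: nat where "C < n * (integral\<^sup>L \<mu> A - \<kappa>)"
      using reals_Archimedean3[of "integral\<^sup>L \<mu> A - \<kappa>"] by auto
    then show False using bound[of n] by simp
  qed
qed

text \<open>Stated for an already chosen limit, so that it can be combined with further properties of the same limit measure.\<close>
lemma krylov_bogolyubov_integral_ge:
  fixes A :: "'a::metric_space \<Rightarrow> real" and \<kappa> C :: real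
  assumes lim: "(\<lambda>k. birkhoff_sum T A (n (r k)) (x (r k)) / n (r k)) \<longlonglongrightarrow> L"
    and n: "filterlim n at_top sequentially" and r: "strict_mono r"
    and ge: "\<And>k. n k * \<kappa> - C \<le> birkhoff_sum T A (n k) (x k)"
  shows "\<kappa> \<le> L"
proof -
  have nr: "filterlim (\<lambda>k. n (r k)) at_top sequentially"
    using filterlim_compose[OF n filterlim_subseq[OF r]] by simp
  have "(\<lambda>k. C / real (n (r k))) \<longlonglongrightarrow> 0"
    using filterlim_compose[OF filterlim_real_sequentially nr]
    by (intro tendsto_divide_0[OF tendsto_const] filterlim_at_top_imp_at_infinity)
  from tendsto_diff[OF tendsto_const[of \<kappa>] this]
  have low: "(\<lambda>k. \<kappa> - C / real (n (r k))) \<longlonglongrightarrow> \<kappa>" by simp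
  have "\<forall>\<^sub>F k in sequentially. \<kappa> - C / real (n (r k)) \<le> birkhoff_sum T A (n (r k)) (x (r k)) / n (r k)"
    using filterlim_at_top[THEN iffD1, OF nr, rule_format, of 1]
  proof eventually_elim
    case (elim k)
    have "(n (r k) * \<kappa> - C) / n (r k) \<le> birkhoff_sum T A (n (r k)) (x (r k)) / n (r k)"
      using ge[of "r k"] by (rule divide_right_mono) simp
    then show ?case using elim by (simp add: diff_divide_distrib)
  qed
  then show ?thesis by (rule tendsto_le[OF trivial_limit_sequentially lim low])
qed

lemma le_maximal_energy_if_birkhoff_sums_ge:
  fixes A :: "'a::metric_space \<Rightarrow> real" and \<kappa> C :: real
  assumes comp: "compact (UNIV :: 'a set)" and T: "continuous_on UNIV T"
    and A: "continuous_on UNIV A" and n: "filterlim n at_top sequentially"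
    and ge: "\<And>k. n k * \<kappa> - C \<le> birkhoff_sum T A (n k) (x k)"
  shows "\<kappa> \<le> maximal_energy T A"
proof -
  obtain r \<mu> where r: "strict_mono r" and \<mu>: "\<mu> \<in> invariant_measures T" and
    lim: "\<And>f::'a \<Rightarrow> real. continuous_on UNIV f \<Longrightarrow>
       (\<lambda>k. birkhoff_sum T f (n (r k)) (x (r k)) / n (r k)) \<longlonglongrightarrow> integral\<^sup>L \<mu> f"
    by (rule krylov_bogolyubov[OF comp T n, where x = x]) (rule that)
  show ?thesis
    using krylov_bogolyubov_integral_ge[OF lim[OF A] n r ge] integral_le_maximal_energy[OF comp A \<mu>] by simp
qed

text \<open>The limit that defines the Mane potential is an infimum, since shrinking the neighbourhoods can only lower the supremum.\<close>
lemma Lim_at_right_monotone: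
  fixes g :: "real \<Rightarrow> ereal"
  assumes "\<And>\<epsilon> \<epsilon>'. 0 < \<epsilon> \<Longrightarrow> \<epsilon> \<le> \<epsilon>' \<Longrightarrow> g \<epsilon> \<le> g \<epsilon>'"
  shows "Lim (at_right 0) g = (INF \<epsilon>\<in>{0<..}. g \<epsilon>)"
proof (rule tendsto_Lim)
  show "(g \<longlongrightarrow> (INF \<epsilon>\<in>{0<..}. g \<epsilon>)) (at_right 0)"
  proof (rule order_tendstoI)
    fix a assume "a < (INF \<epsilon>\<in>{0<..}. g \<epsilon>)"
    then have "a < g \<epsilon>" if "0 < \<epsilon>" for \<epsilon> using that by (auto dest: less_INF_D)
    then show "\<forall>\<^sub>F \<epsilon> in at_right 0. a < g \<epsilon>"
      using eventually_at_right_less[of 0] by (auto elim: eventually_mono)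
  next
    fix a assume "(INF \<epsilon>\<in>{0<..}. g \<epsilon>) < a"
    then obtain e where e: "0 < e" "g e < a" by (auto simp: INF_less_iff)
    have "\<forall>\<^sub>F \<epsilon> in at_right 0. 0 < \<epsilon> \<and> \<epsilon> < e"
      using e(1) by (auto simp: eventually_at_right_field)
    then show "\<forall>\<^sub>F \<epsilon> in at_right 0. g \<epsilon> < a"
    proof eventually_elim
      case (elim \<epsilon>)
      then show ?case using assms[of \<epsilon> e] e(2) by simp
    qed
  qed
qed simp

section \<open>The Mane potential through reachable values\<close>

text \<open>The hypotheses isolate the outcome of the pullback theorem: \<open>\<rho>\<close> is the admissible displacement of
an endpoint, \<open>s\<close> the contraction rate of inverse branches and \<open>K\<close> the distortion constant.\<close>
locale shadowing_system =
  fixes T :: "'a::metric_space \<Rightarrow> 'a" and A :: "'a \<Rightarrow> real" and \<alpha> \<rho> K s :: real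
  assumes comp: "compact (UNIV :: 'a set)"
    and T_cont: "continuous_on UNIV T"
    and A_cont: "continuous_on UNIV A"
    and \<alpha>_pos: "0 < \<alpha>" and \<rho>_pos: "0 < \<rho>" and K_nonneg: "0 \<le> K" and s_pos: "0 < s" and s_less: "s < 1"
    and pullback_raw: "dist ((T ^^ n) x) y \<le> \<rho> \<Longrightarrow> \<exists>x'. (T ^^ n) x' = y \<and>
        dist x x' \<le> s ^ n * dist ((T ^^ n) x) y \<and>
        \<bar>birkhoff_sum T A n x - birkhoff_sum T A n x'\<bar> \<le> K * dist ((T ^^ n) x) y powr \<alpha>"
begin

abbreviation Q :: real where "Q \<equiv> maximal_energy T A"
abbreviation B :: "'a \<Rightarrow> real" where "B \<equiv> normalized T A"
abbreviation S :: "nat \<Rightarrow> 'a \<Rightarrow> real" where "S \<equiv> birkhoff_sum T (normalized T A)"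

text \<open>The pullback property in one-sided form, normalised by \<open>Q\<close> and with the distance replaced by an upper bound.\<close>
lemma pullback:
  assumes "dist ((T ^^ n) x) y \<le> D" "D \<le> \<rho>"
  obtains x' where "(T ^^ n) x' = y" "dist x x' \<le> s ^ n * D" "dist x x' \<le> D"
    "S n x - K * D powr \<alpha> \<le> S n x'"
proof -
  obtain x' where x': "(T ^^ n) x' = y" "dist x x' \<le> s ^ n * dist ((T ^^ n) x) y"
    "\<bar>birkhoff_sum T A n x - birkhoff_sum T A n x'\<bar> \<le> K * dist ((T ^^ n) x) y powr \<alpha>"
    using pullback_raw[of n x y] assms by auto
  have D: "0 \<le> D" using order_trans[OF zero_le_dist assms(1)] .
  have *: "s ^ n * dist ((T ^^ n) x) y \<le> s ^ n * D"
    using assms s_pos by (intro mult_left_mono) auto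
  have "s ^ n * D \<le> 1 * D" using D s_pos s_less by (intro mult_right_mono power_le_one) auto
  moreover have "K * dist ((T ^^ n) x) y powr \<alpha> \<le> K * D powr \<alpha>"
    using assms K_nonneg \<alpha>_pos by (intro mult_left_mono powr_mono2) auto
  ultimately show thesis
    using that[of x'] x' * by (simp add: birkhoff_sum_normalized)
qed

lemma small_scale:
  assumes "0 < \<epsilon>"
  obtains \<delta> where "0 < \<delta>" "\<delta> \<le> \<epsilon>" "\<delta> \<le> \<rho>" "K * \<delta> powr \<alpha> \<le> \<epsilon>"
proof
  (* K + 1 instead of K avoids division by zero *)
  define \<delta> where "\<delta> = min \<epsilon> (min \<rho> ((\<epsilon> / (K + 1)) powr (1 / \<alpha>)))"
  have e: "0 < \<epsilon> / (K + 1)" using assms K_nonneg by simp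
  show "0 < \<delta>" using assms \<rho>_pos K_nonneg by (simp add: \<delta>_def)
  then have "\<delta> powr \<alpha> \<le> ((\<epsilon> / (K + 1)) powr (1 / \<alpha>)) powr \<alpha>"
    using \<alpha>_pos by (intro powr_mono2) (auto simp: \<delta>_def)
  also have "\<dots> = \<epsilon> / (K + 1)" using assms K_nonneg \<alpha>_pos by (subst powr_powr) simp
  finally have "K * \<delta> powr \<alpha> \<le> K * (\<epsilon> / (K + 1))" using K_nonneg by (rule mult_left_mono)
  also have "\<dots> \<le> \<epsilon>" using assms K_nonneg by (simp add: field_simps)
  finally show "K * \<delta> powr \<alpha> \<le> \<epsilon>" .
qed auto

lemma normalized_cont: "continuous_on UNIV B"
  unfolding normalized_def using A_cont by (intro continuous_intros)

text \<open>Otherwise long orbit segments with larger averages would produce an invariant measure of energy above \<open>Q\<close>.\<close>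
lemma birkhoff_sums_sublinear:
  fixes a :: real
  assumes "0 < a"
  shows "\<exists>N. \<forall>n\<ge>N. \<forall>x. S n x \<le> n * a"
proof (rule ccontr)
  assume "\<not> ?thesis"
  then have "\<forall>N. \<exists>n x. N \<le> n \<and> n * a < S n x" by (auto simp: not_le)
  then obtain n x where nx: "\<And>k. k \<le> n k" "\<And>k::nat. n k * a < S (n k) (x k)" by metis
  have "filterlim n at_top sequentially"
    by (rule filterlim_at_top_mono[OF filterlim_ident]) (use nx in auto)
  moreover have "n k * (a + Q) - 0 \<le> birkhoff_sum T A (n k) (x k)" for k
    using nx(2)[of k] by (simp add: birkhoff_sum_normalized distrib_left)
  ultimately have "a + Q \<le> Q"
    by (rule le_maximal_energy_if_birkhoff_sums_ge[OF comp T_cont A_cont])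
  then show False using assms by simp
qed

text \<open>An orbit segment that nearly returns to its starting point can be pulled back along itself any number of times,
each lap losing at most \<open>K * \<rho> powr \<alpha>\<close>. A larger sum would therefore make Birkhoff sums grow linearly. The
threshold \<open>(1 - s) * \<rho>\<close> keeps all the successive starting points within \<open>\<rho>\<close> of the endpoint.\<close>
lemma almost_closed_orbit_sum_le:
  assumes m: "1 \<le> m" and close: "dist ((T ^^ m) x) x \<le> (1 - s) * \<rho>"
  shows "S m x \<le> K * \<rho> powr \<alpha>"
proof (rule ccontr)
  assume neg: "\<not> ?thesis"
  define b where "b = S m x - K * \<rho> powr \<alpha>"
  have b: "0 < b" using neg by (simp add: b_def)
  have "\<exists>y. dist ((T ^^ m) x) y \<le> \<rho> \<and> k * b \<le> S (k * m) y" for k :: nat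
  proof (induction k)
    case 0
    then show ?case using \<rho>_pos by (intro exI[of _ "(T ^^ m) x"]) simp
  next
    case (Suc k)
    then obtain y where y: "dist ((T ^^ m) x) y \<le> \<rho>" "k * b \<le> S (k * m) y" by blast
    obtain y' where y': "(T ^^ m) y' = y" "dist x y' \<le> s ^ m * \<rho>" "S m x - K * \<rho> powr \<alpha> \<le> S m y'"
      using pullback[OF y(1)] by blast
    have "s ^ m * \<rho> \<le> s ^ 1 * \<rho>"
      using m s_pos s_less \<rho>_pos by (intro mult_right_mono power_decreasing) auto
    then have "dist ((T ^^ m) x) y' \<le> \<rho>"
      using close y'(2) dist_triangle[of "(T ^^ m) x" y' x] by (simp add: left_diff_distrib)
    moreover have "Suc k * b \<le> S (Suc k * m) y'"
    proof -
      have "S (Suc k * m) y' = S m y' + S (k * m) y"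
        using y'(1) birkhoff_sum_add[of T B m "k * m" y'] by simp
      moreover have "Suc k * b = b + k * b" by (simp add: distrib_right)
      moreover have "b \<le> S m y'" using y'(3) by (simp add: b_def)
      ultimately show ?thesis using y(2) by linarith
    qed
    ultimately show ?case by blast
  qed
  then obtain y where y: "\<And>k::nat. k * b \<le> S (k * m) (y k)" by metis
  have "0 < b / (2 * m)" using b m by simp
  then obtain N where N: "\<And>n x. N \<le> n \<Longrightarrow> S n x \<le> n * (b / (2 * m))"
    using birkhoff_sums_sublinear by blast
  have "N \<le> Suc N * m" using m mult_le_mono2[of 1 m "Suc N"] by simp
  then have "Suc N * b \<le> real (Suc N * m) * (b / (2 * m))"
    using y[of "Suc N"] N[of "Suc N * m" "y (Suc N)"] by linarith
  also have "\<dots> = Suc N * b / 2" using m by (simp add: field_simps)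
  also have "\<dots> < Suc N * b" using b by simp
  finally show False by simp
qed

text \<open>Cover the space by finitely many small balls. Between its first and its last visit to a given ball an orbit nearly closes up,
so that stretch contributes a bounded amount, and the two remaining stretches avoid this ball. Induction on the number
of balls bounds the whole sum.\<close>
lemma birkhoff_sums_bounded_above: "\<exists>C\<ge>0. \<forall>n x. S n x \<le> C"
proof -
  define \<delta> where "\<delta> = (1 - s) * \<rho> / 2"
  have \<delta>: "0 < \<delta>" using s_less \<rho>_pos by (simp add: \<delta>_def)
  obtain R where R: "0 < R" "\<And>x. \<bar>B x\<bar> \<le> R"
    using compact_UNIV_continuous_bounded[OF comp normalized_cont] by blast
  define L where "L = K * \<rho> powr \<alpha> + R"
  have L: "0 \<le> L" using K_nonneg R by (simp add: L_def)
  obtain F :: "'a set" where F: "finite F" "UNIV \<subseteq> (\<Union>d\<in>F. ball d \<delta>)"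
    using comp \<delta> unfolding compact_eq_totally_bounded by blast
  have "\<exists>C\<ge>0. \<forall>n x. (\<forall>i<n. (T ^^ i) x \<in> (\<Union>d\<in>P. ball d \<delta>)) \<longrightarrow> S n x \<le> C" if "finite P" for P
    using that
  proof (induction P)
    case empty
    have "S n x \<le> 0" if "\<forall>i<n. (T ^^ i) x \<in> (\<Union>d\<in>{}. ball d \<delta>)" for n x
      using that by (cases n) auto
    then show ?case by blast
  next
    case (insert p P)
    then obtain C where C: "0 \<le> C"
      "\<And>n x. (\<And>i. i < n \<Longrightarrow> (T ^^ i) x \<in> (\<Union>d\<in>P. ball d \<delta>)) \<Longrightarrow> S n x \<le> C" by metis
    (* C for the stretches before the first and after the last visit to the new ball, L for the stretch in between and the step leaving the ball *)
    have "S n x \<le> 2 * C + L" if vis: "\<forall>i<n. (T ^^ i) x \<in> (\<Union>d\<in>insert p P. ball d \<delta>)" for n x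
    proof (cases "\<exists>i<n. (T ^^ i) x \<in> ball p \<delta>")
      case False
      then have "S n x \<le> C" using vis by (intro C(2)) auto
      then show ?thesis using C(1) L by simp
    next
      case True
      define I where "I = {i. i < n \<and> (T ^^ i) x \<in> ball p \<delta>}"
      have I: "finite I" "I \<noteq> {}" using True by (auto simp: I_def)
      define i j where "i = Min I" and "j = Max I"
      have ij: "i \<in> I" "j \<in> I" "i \<le> j" using I by (auto simp: i_def j_def)
      have out: "(T ^^ k) x \<in> (\<Union>d\<in>P. ball d \<delta>)" if "k < n" "k < i \<or> j < k" for k
      proof -
        have "k \<notin> I" using that(2) I Min_le[of I k] Max_ge[of I k] by (auto simp: i_def j_def)
        then show ?thesis using that(1) vis by (auto simp: I_def)
      qed
      have comp_pow: "(T ^^ b) ((T ^^ a) x) = (T ^^ (a + b)) x" for a b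
        by (simp add: funpow_add add.commute[of a b])
      have first: "S i x \<le> C" using out ij by (intro C(2)) (auto simp: I_def)
      have mid: "S (j - i) ((T ^^ i) x) \<le> K * \<rho> powr \<alpha>"
      proof (cases "i = j")
        case True
        then show ?thesis using K_nonneg by simp
      next
        case False
        have "dist ((T ^^ j) x) ((T ^^ i) x) \<le> (1 - s) * \<rho>"
          using ij dist_triangle[of "(T ^^ j) x" "(T ^^ i) x" p]
          by (simp add: I_def \<delta>_def dist_commute)
        then show ?thesis
          using False ij by (intro almost_closed_orbit_sum_le) (auto simp: comp_pow)
      qed
      have last: "S (n - Suc j) ((T ^^ Suc j) x) \<le> C"
      proof (rule C(2))
        fix k assume "k < n - Suc j"
        then show "(T ^^ k) ((T ^^ Suc j) x) \<in> (\<Union>d\<in>P. ball d \<delta>)"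
          unfolding comp_pow using ij by (intro out) auto
      qed
      have "n = i + ((j - i) + (1 + (n - Suc j)))" using ij by (auto simp: I_def)
      then have "S n x = S (i + ((j - i) + (1 + (n - Suc j)))) x" by simp
      also have "\<dots> = S i x + S (j - i) ((T ^^ i) x) + B ((T ^^ j) x) + S (n - Suc j) ((T ^^ Suc j) x)"
        using ij by (simp only: birkhoff_sum_add comp_pow) (simp del: funpow.simps)
      finally show ?thesis using first mid last R(2)[of "(T ^^ j) x"] by (simp add: L_def del: funpow.simps)
    qed
    moreover have "0 \<le> 2 * C + L" using C(1) L by simp
    ultimately show ?case by blast
  qed
  from this[OF F(1)] show ?thesis using F(2) by blast
qed

text \<open>\<open>reach N x y c\<close> says that the Mane potential from \<open>x\<close> to \<open>y\<close>, with the
supremum restricted to at least \<open>N\<close> steps, is at least \<open>c\<close>. The single tolerance \<open>\<epsilon>\<close> serves for the endpoints and for the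
value.\<close>
definition reach :: "nat \<Rightarrow> 'a \<Rightarrow> 'a \<Rightarrow> real \<Rightarrow> bool" where
  "reach N x y c \<longleftrightarrow> (\<forall>\<epsilon>>0. \<exists>n\<ge>N. \<exists>z. dist z x \<le> \<epsilon> \<and> dist ((T ^^ n) z) y \<le> \<epsilon> \<and> c - \<epsilon> \<le> S n z)"

lemma reachE:
  assumes "reach N x y c" "0 < \<epsilon>"
  obtains n z where "N \<le> n" "dist z x \<le> \<epsilon>" "dist ((T ^^ n) z) y \<le> \<epsilon>" "c - \<epsilon> \<le> S n z"
  using assms unfolding reach_def by blast

lemma reachI:
  assumes "\<And>\<epsilon>. 0 < \<epsilon> \<Longrightarrow> \<exists>n z. N \<le> n \<and> dist z x \<le> \<epsilon> \<and> dist ((T ^^ n) z) y \<le> \<epsilon> \<and> c - \<epsilon> \<le> S n z"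
  shows "reach N x y c"
  using assms unfolding reach_def by blast

lemma reach_mono:
  assumes "reach N x y c" "M \<le> N" "d \<le> c"
  shows "reach M x y d"
proof (rule reachI)
  fix \<epsilon> :: real assume "0 < \<epsilon>"
  from reachE[OF assms(1) this] obtain n z where
    "N \<le> n" "dist z x \<le> \<epsilon>" "dist ((T ^^ n) z) y \<le> \<epsilon>" "c - \<epsilon> \<le> S n z" .
  then show "\<exists>n z. M \<le> n \<and> dist z x \<le> \<epsilon> \<and> dist ((T ^^ n) z) y \<le> \<epsilon> \<and> d - \<epsilon> \<le> S n z"
    using assms(2,3) by (intro exI[of _ n] exI[of _ z]) auto
qed

lemma reach_orbit: "reach n x ((T ^^ n) x) (S n x)"
  by (rule reachI, intro exI[of _ n] exI[of _ x]) auto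

text \<open>Since the endpoints in the definition are only approximate, reachability is closed under limits; this is the upper
semicontinuity of the Mane potential.\<close>
lemma reach_limit:
  assumes "\<And>\<epsilon>. 0 < \<epsilon> \<Longrightarrow> \<exists>x' y' c'. dist x' x \<le> \<epsilon> \<and> dist y' y \<le> \<epsilon> \<and> c - \<epsilon> \<le> c' \<and> reach N x' y' c'"
  shows "reach N x y c"
proof (rule reachI)
  fix \<epsilon> :: real assume e: "0 < \<epsilon>"
  then obtain x' y' c' where *: "dist x' x \<le> \<epsilon>/2" "dist y' y \<le> \<epsilon>/2" "c - \<epsilon>/2 \<le> c'" "reach N x' y' c'"
    using assms[of "\<epsilon>/2"] by auto
  obtain n z where z: "N \<le> n" "dist z x' \<le> \<epsilon>/2" "dist ((T ^^ n) z) y' \<le> \<epsilon>/2" "c' - \<epsilon>/2 \<le> S n z"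
    using reachE[OF *(4), of "\<epsilon>/2"] e by auto
  show "\<exists>n z. N \<le> n \<and> dist z x \<le> \<epsilon> \<and> dist ((T ^^ n) z) y \<le> \<epsilon> \<and> c - \<epsilon> \<le> S n z"
    using * z dist_triangle[of z x x'] dist_triangle[of "(T ^^ n) z" y y']
    by (intro exI[of _ n] exI[of _ z]) auto
qed

lemma reach_bounded: "\<exists>C\<ge>0. \<forall>N x y c. reach N x y c \<longrightarrow> c \<le> C"
proof -
  obtain C where C: "0 \<le> C" "\<And>n x. S n x \<le> C" using birkhoff_sums_bounded_above by blast
  have "c \<le> C" if r: "reach N x y c" for N x y c
  proof (rule field_le_epsilon)
    fix e :: real assume "0 < e"
    from reachE[OF r this] obtain n z where "c - e \<le> S n z" by blast
    then show "c \<le> C + e" using C(2)[of n z] by simp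
  qed
  then show ?thesis using C(1) by blast
qed

text \<open>Pulling back moves the approximate endpoint onto \<open>y\<close>.\<close>
lemma reach_exact:
  assumes r: "reach N x y c" and e: "0 < \<epsilon>"
  obtains n z where "N \<le> n" "dist z x \<le> \<epsilon>" "(T ^^ n) z = y" "c - \<epsilon> \<le> S n z"
proof -
  obtain \<delta> where \<delta>: "0 < \<delta>" "\<delta> \<le> \<epsilon>/2" "\<delta> \<le> \<rho>" "K * \<delta> powr \<alpha> \<le> \<epsilon>/2"
    using small_scale[of "\<epsilon>/2"] e by auto
  obtain n z where z: "N \<le> n" "dist z x \<le> \<delta>" "dist ((T ^^ n) z) y \<le> \<delta>" "c - \<delta> \<le> S n z"
    using reachE[OF r \<delta>(1)] .
  obtain z' where z': "(T ^^ n) z' = y" "dist z z' \<le> \<delta>" "S n z - K * \<delta> powr \<alpha> \<le> S n z'"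
    using pullback[OF z(3) \<delta>(3)] by blast
  show thesis
    using that[OF z(1) _ z'(1)] z z' \<delta> dist_triangle[of z' x z] by (simp add: dist_commute)
qed

text \<open>The triangle inequality for the Mane potential, with control of the number of steps: the first segment is pulled back so that it
ends where the second one starts.\<close>
lemma reach_trans:
  assumes xy: "reach N x y c" and yz: "reach M y z d"
  shows "reach (N + M) x z (c + d)"
proof (rule reachI)
  fix \<epsilon> :: real assume e: "0 < \<epsilon>"
  obtain \<delta> where \<delta>: "0 < \<delta>" "\<delta> \<le> \<epsilon>/3" "\<delta> \<le> \<rho>" "K * \<delta> powr \<alpha> \<le> \<epsilon>/3"
    using small_scale[of "\<epsilon>/3"] e by auto
  obtain n u where u: "N \<le> n" "dist u x \<le> \<delta>" "(T ^^ n) u = y" "c - \<delta> \<le> S n u"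
    using reach_exact[OF xy \<delta>(1)] .
  obtain m w where w: "M \<le> m" "dist w y \<le> \<delta>" "dist ((T ^^ m) w) z \<le> \<delta>" "d - \<delta> \<le> S m w"
    using reachE[OF yz \<delta>(1)] .
  have "dist ((T ^^ n) u) w \<le> \<delta>" using u w by (simp add: dist_commute)
  from pullback[OF this \<delta>(3)] obtain u' where
    u': "(T ^^ n) u' = w" "dist u u' \<le> \<delta>" "S n u - K * \<delta> powr \<alpha> \<le> S n u'" by blast
  have "(T ^^ (n + m)) u' = (T ^^ m) w" using u'(1) by (simp add: add.commute[of n] funpow_add)
  moreover have "S (n + m) u' = S n u' + S m w" using u'(1) by (simp add: birkhoff_sum_add)
  ultimately show "\<exists>n z'. N + M \<le> n \<and> dist z' x \<le> \<epsilon> \<and> dist ((T ^^ n) z') z \<le> \<epsilon> \<and> c + d - \<epsilon> \<le> S n z'"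
    using u w u' \<delta> dist_triangle[of u' x u]
    by (intro exI[of _ "n + m"] exI[of _ u']) (auto simp: dist_commute)
qed

lemma reach_trans_1:
  assumes "reach 1 x y c" "reach 1 y z d"
  shows "reach 1 x z (c + d)"
  using reach_mono[OF reach_trans[OF assms]] by simp

text \<open>The finite values below the potential are exactly the reachable ones, so that the Mane potential
can be handled with real numbers only.\<close>
lemma mane_potential_ge_iff: "ereal c \<le> mane_potential T A x y \<longleftrightarrow> reach 1 x y c"
proof -
  define g where "g \<epsilon> = (SUP n\<in>{1..}. SUP z\<in>{z. dist z x \<le> \<epsilon> \<and> dist ((T ^^ n) z) y \<le> \<epsilon>}.
         ereal (S n z))" for \<epsilon>
  have mono: "g \<epsilon> \<le> g \<epsilon>'" if "\<epsilon> \<le> \<epsilon>'" for \<epsilon> \<epsilon>'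
    unfolding g_def using that by (intro SUP_mono' SUP_subset_mono) auto
  have inf: "mane_potential T A x y = (INF \<epsilon>\<in>{0<..}. g \<epsilon>)"
    unfolding mane_potential_def g_def[symmetric] by (rule Lim_at_right_monotone[OF mono])
  show ?thesis
  proof
    assume le: "ereal c \<le> mane_potential T A x y"
    show "reach 1 x y c"
    proof (rule reachI)
      fix \<epsilon> :: real assume e: "0 < \<epsilon>"
      have "ereal (c - \<epsilon>) < ereal c" using e by simp
      also have "\<dots> \<le> g \<epsilon>" using le e unfolding inf by (auto simp: le_INF_iff)
      finally show "\<exists>n z. 1 \<le> n \<and> dist z x \<le> \<epsilon> \<and> dist ((T ^^ n) z) y \<le> \<epsilon> \<and> c - \<epsilon> \<le> S n z"
        unfolding g_def by (fastforce simp: less_SUP_iff)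
    qed
  next
    assume r: "reach 1 x y c"
    have "ereal c \<le> g \<epsilon>" if e: "0 < \<epsilon>" for \<epsilon>
    proof (rule ccontr)
      assume "\<not> ereal c \<le> g \<epsilon>"
      then obtain q where q: "g \<epsilon> < ereal q" "ereal q < ereal c"
        using ereal_dense2[of "g \<epsilon>" "ereal c"] by (auto simp: not_le)
      define \<delta> where "\<delta> = min \<epsilon> (c - q)"
      have "0 < \<delta>" using e q by (simp add: \<delta>_def)
      from reachE[OF r this] obtain n z where
        z: "1 \<le> n" "dist z x \<le> \<delta>" "dist ((T ^^ n) z) y \<le> \<delta>" "c - \<delta> \<le> S n z" .
      have "ereal q \<le> ereal (S n z)" using z(4) by (simp add: \<delta>_def)
      also have "\<dots> \<le> g \<delta>"
        unfolding g_def using z by (intro SUP_upper2[of n] SUP_upper2[of z]) auto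
      also have "\<dots> \<le> g \<epsilon>" by (rule mono) (simp add: \<delta>_def)
      finally show False using q(1) by simp
    qed
    then show "ereal c \<le> mane_potential T A x y" unfolding inf by (auto intro: INF_greatest)
  qed
qed

lemma mane_potential_not_PInf: "mane_potential T A x y \<noteq> \<infinity>"
proof
  assume "mane_potential T A x y = \<infinity>"
  then have "reach 1 x y c" for c using mane_potential_ge_iff[of c x y] by simp
  moreover obtain C where "\<And>c. reach 1 x y c \<Longrightarrow> c \<le> C" using reach_bounded by blast
  ultimately have "C + 1 \<le> C" by blast
  then show False by simp
qed

lemma mane_potential_eq_shift:
  assumes "\<And>d. reach 1 x' y' d \<longleftrightarrow> reach 1 x y (d - e)"
  shows "mane_potential T A x' y' = mane_potential T A x y \<otimes>\<^sub>t ereal e"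
proof -
  have *: "ereal d \<le> mane_potential T A x' y' \<longleftrightarrow> ereal (d - e) \<le> mane_potential T A x y" for d
    using assms by (simp add: mane_potential_ge_iff)
  show ?thesis
  proof (cases "mane_potential T A x y")
    case (real r)
    have le: "ereal (r + e) \<le> mane_potential T A x' y'" using *[of "r + e"] real by simp
    then obtain r' where r': "mane_potential T A x' y' = ereal r'"
      using mane_potential_not_PInf[of x' y'] by (cases "mane_potential T A x' y'") auto
    have "r' - e \<le> r" using *[of r'] real r' by simp
    then show ?thesis using le real r' by (simp add: trop_mult_def)
  next
    case MInf
    then show ?thesis
      using * mane_potential_not_PInf[of x' y']
      by (cases "mane_potential T A x' y'") (auto simp: trop_mult_def)
  qed (use mane_potential_not_PInf in auto)
qed

end

section \<open>Eigenfunctions and eigendensities\<close>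

lemma trop_mult_ereal [simp]: "ereal a \<otimes>\<^sub>t ereal b = ereal (a + b)"
  by (simp add: trop_mult_def)

lemma trop_mult_MInf [simp]: "-\<infinity> \<otimes>\<^sub>t a = -\<infinity>" "a \<otimes>\<^sub>t -\<infinity> = -\<infinity>"
  by (auto simp: trop_mult_def)

lemma compact_UNIV_subsequence:
  fixes f :: "nat \<Rightarrow> 'a::metric_space"
  assumes "compact (UNIV :: 'a set)"
  obtains l r where "strict_mono (r :: nat \<Rightarrow> nat)" "(\<lambda>k. f (r k)) \<longlonglongrightarrow> l"
proof -
  have "seq_compact (UNIV :: 'a set)" using assms by (simp add: compact_eq_seq_compact_metric)
  then obtain l r where "strict_mono (r :: nat \<Rightarrow> nat)" "(f \<circ> r) \<longlonglongrightarrow> l"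
    by (rule seq_compactE[where f = f]) auto
  then show thesis using that by (simp add: comp_def)
qed

text \<open>The eigenvalue is finite because \<open>u + A\<close> is bounded and some fibre is nonempty. A finite
eigenvalue makes every fibre nonempty, and suprema over the compact fibres are attained. So an eigenfunction is a subsolution that is
exact along some preimage of every point.\<close>
lemma tropical_eigenfunction_calibrated:
  fixes A :: "'a::metric_space \<Rightarrow> real"
  assumes comp: "compact (UNIV :: 'a set)" and T: "continuous_on UNIV T"
    and A: "continuous_on UNIV A" and eig: "tropical_eigenfunction T A v"
  obtains u k where "v = (\<lambda>x. ereal (u x))" "continuous_on UNIV u"
    "\<And>y. u y + A y \<le> u (T y) + k" "\<And>x. \<exists>y. T y = x \<and> u y + A y = u x + k"
proof -
  obtain u where v: "v = (\<lambda>x. ereal (u x))" and u: "continuous_on UNIV u"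
    using eig by (auto simp: tropical_eigenfunction_def real_continuous_functions_def)
  obtain \<kappa> where \<kappa>: "bousch T A v = (\<lambda>x. v x \<otimes>\<^sub>t \<kappa>)"
    using eig by (auto simp: tropical_eigenfunction_def)
  have sup: "(SUP y\<in>T -` {x}. ereal (u y + A y)) = ereal (u x) \<otimes>\<^sub>t \<kappa>" for x
    using fun_cong[OF \<kappa>, of x] by (simp add: bousch_def v)
  have uA: "continuous_on UNIV (\<lambda>y. u y + A y)" using u A by (intro continuous_intros)
  obtain R where R: "\<And>y. \<bar>u y + A y\<bar> \<le> R" using compact_UNIV_continuous_bounded[OF comp uA] by blast
  have below: "ereal (u y + A y) \<le> ereal (u (T y)) \<otimes>\<^sub>t \<kappa>" for y
    unfolding sup[symmetric] by (rule SUP_upper) simp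
  have above: "ereal (u x) \<otimes>\<^sub>t \<kappa> \<le> ereal R" for x
    unfolding sup[symmetric] using R abs_le_D1 by (intro SUP_least) auto
  obtain k where k: "\<kappa> = ereal k"
  proof (cases \<kappa>)
    case PInf
    then show ?thesis using above[of undefined] by (simp add: trop_mult_def)
  next
    case MInf
    then show ?thesis using below[of undefined] by simp
  qed
  show thesis
  proof
    show "u y + A y \<le> u (T y) + k" for y using below[of y] by (simp add: k)
    fix x
    have ne: "T -` {x} \<noteq> {}"
    proof
      assume e: "T -` {x} = {}"
      show False using sup[of x] unfolding e k by (simp add: bot_ereal_def)
    qed
    have "closed (T -` {x})" using T by (intro closed_vimage) auto
    then have "compact (T -` {x})" using compact_Int_closed[OF comp] by simp
    then obtain y where y: "y \<in> T -` {x}" "\<forall>z\<in>T -` {x}. u z + A z \<le> u y + A y"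
      using continuous_attains_sup[OF _ ne continuous_on_subset[OF uA]] by blast
    have "(SUP z\<in>T -` {x}. ereal (u z + A z)) = ereal (u y + A y)"
      using y by (intro antisym SUP_least SUP_upper) auto
    then show "\<exists>y. T y = x \<and> u y + A y = u x + k"
      using sup[of x] y by (auto simp: k)
  qed (use u v in auto)
qed

lemma birkhoff_sum_le_coboundary:
  fixes u :: "'a \<Rightarrow> real" and T :: "'a \<Rightarrow> 'a"
  assumes "\<And>y. u y + A y \<le> u (T y) + k"
  shows "birkhoff_sum T A n x \<le> u ((T ^^ n) x) - u x + n * k"
proof (induction n)
  case (Suc n)
  then show ?case using assms[of "(T ^^ n) x"] by (simp add: birkhoff_sum_def distrib_right)
qed simp

lemma birkhoff_sum_calibrated_preorbit:
  fixes u :: "'a \<Rightarrow> real" and T g :: "'a \<Rightarrow> 'a"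
  assumes g: "\<And>x. T (g x) = x" "\<And>x. u (g x) + A (g x) = u x + k"
  shows "(T ^^ i) ((g ^^ (i + j)) y) = (g ^^ j) y \<and>
    birkhoff_sum T A i ((g ^^ (i + j)) y) = u ((g ^^ j) y) - u ((g ^^ (i + j)) y) + i * k"
proof (induction i)
  case (Suc i)
  have g_step: "(g ^^ (Suc i + j)) y = g ((g ^^ (i + j)) y)" by simp
  have T_step: "(T ^^ Suc i) (g z) = (T ^^ i) z" for z
    by (simp only: funpow_Suc_right comp_apply g)
  show ?case
    using Suc g(2)[of "(g ^^ (i + j)) y"]
    unfolding g_step T_step birkhoff_sum_Suc_left g(1) by (simp add: distrib_right)
qed simp

lemma upper_semicontinuous_bounded_above:
  fixes b :: "'a::metric_space \<Rightarrow> ereal"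
  assumes comp: "compact (UNIV :: 'a set)" and fin: "\<And>x. b x \<noteq> \<infinity>"
    and usc: "\<And>c::real. open {x. b x < ereal c}"
  obtains M :: real where "\<And>x. b x < ereal M"
proof -
  have "UNIV \<subseteq> (\<Union>n::nat. {x. b x < ereal n})"
  proof
    fix x
    obtain n :: nat where "b x < ereal n"
      using fin[of x] reals_Archimedean2 by (cases "b x") auto
    then show "x \<in> (\<Union>n::nat. {x. b x < ereal n})" by blast
  qed
  then obtain F :: "nat set" where F: "finite F" "UNIV \<subseteq> (\<Union>n\<in>F. {x. b x < ereal n})"
    using compactE_image[OF comp, of UNIV "\<lambda>n::nat. {x. b x < ereal n}"] usc by metis
  have "b x < ereal (real (Max F))" for x
  proof -
    obtain n where n: "n \<in> F" "b x < ereal (real n)" using F(2) by blast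
    then have "ereal (real n) \<le> ereal (real (Max F))" using F(1) by simp
    with n(2) show ?thesis by (rule less_le_trans)
  qed
  then show thesis using that by blast
qed

lemma tropical_eigendensityD:
  assumes "tropical_eigendensity T A b"
  shows "b x \<noteq> \<infinity>" "open {x. b x < ereal c}" "\<exists>x. b x \<noteq> -\<infinity>"
    "\<exists>\<kappa>. \<forall>x. b (T x) \<otimes>\<^sub>t ereal (A x) = b x \<otimes>\<^sub>t \<kappa>"
proof -
  have b: "b \<in> tropical_densities" "b \<noteq> (\<lambda>x. \<infinity>)" "b \<noteq> (\<lambda>x. -\<infinity>)"
    using assms by (auto simp: tropical_eigendensity_def)
  show "b x \<noteq> \<infinity>" "open {x. b x < ereal c}" using b by (auto simp: tropical_densities_def)
  show "\<exists>x. b x \<noteq> -\<infinity>" using b(3) by (simp add: fun_eq_iff)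
  show "\<exists>\<kappa>. \<forall>x. b (T x) \<otimes>\<^sub>t ereal (A x) = b x \<otimes>\<^sub>t \<kappa>"
    using assms by (simp add: tropical_eigendensity_def bousch_adjoint_def fun_eq_iff)
qed

lemma density_along_orbit:
  fixes T :: "'a \<Rightarrow> 'a"
  assumes eq: "\<And>x. b (T x) \<otimes>\<^sub>t ereal (A x) = b x \<otimes>\<^sub>t ereal k"
  shows "b ((T ^^ n) x) \<otimes>\<^sub>t ereal (birkhoff_sum T A n x) = b x \<otimes>\<^sub>t ereal (n * k)"
proof (induction n)
  case 0
  then show ?case by simp
next
  case (Suc n)
  show ?case
    using Suc eq[of "(T ^^ n) x"]
    by (cases "b x"; cases "b ((T ^^ n) x)"; cases "b (T ((T ^^ n) x))")
      (auto simp: trop_mult_def birkhoff_sum_def distrib_right)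
qed

text \<open>The image is open and compact, hence clopen, and no orbit that starts in it leaves it.\<close>
lemma open_transitive_imp_surj:
  fixes T :: "'a::metric_space \<Rightarrow> 'a"
  assumes comp: "compact (UNIV :: 'a set)" and T: "continuous_on UNIV T"
    and op: "open_map euclidean euclidean T" and tr: "topologically_transitive T"
  shows "surj T"
proof (rule ccontr)
  assume "\<not> surj T"
  then have ne: "- range T \<noteq> {}" by auto
  have "open (range T)" using op by (simp add: open_map_def)
  moreover have "open (- range T)"
    using compact_imp_closed[OF compact_continuous_image[OF T comp]] by (simp add: open_Compl)
  ultimately obtain n where n: "(T ^^ n) ` range T \<inter> - range T \<noteq> {}"
    using tr ne unfolding topologically_transitive_def by (metis empty_iff rangeI)
  have "(T ^^ n) ` range T \<subseteq> range T" by (auto simp: funpow_swap1[symmetric])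
  then show False using n by blast
qed

context shadowing_system
begin

lemma aubry_imp_reach:
  assumes "x \<in> aubry_set T A"
  shows "reach 1 x x 0"
proof (rule reachI)
  fix \<epsilon> :: real assume "0 < \<epsilon>"
  then obtain y n where "1 \<le> n" "dist x y \<le> \<epsilon>" "dist ((T ^^ n) y) x \<le> \<epsilon>" "\<bar>S n y\<bar> \<le> \<epsilon>"
    using assms unfolding aubry_set_def by blast
  then show "\<exists>n z. 1 \<le> n \<and> dist z x \<le> \<epsilon> \<and> dist ((T ^^ n) z) x \<le> \<epsilon> \<and> 0 - \<epsilon> \<le> S n z"
    by (intro exI[of _ n] exI[of _ y]) (auto simp: dist_commute)
qed

text \<open>Iterating a loop shows that a return with almost vanishing sum can be made arbitrarily long, even though the definition of the
Aubry set asks only for one step.\<close>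
lemma reach_loop_long:
  assumes "reach 1 x x 0"
  shows "reach N x x 0"
proof (induction N)
  case 0
  show ?case using reach_mono[OF assms] by simp
next
  case (Suc N)
  then show ?case using reach_trans[OF Suc assms] by simp
qed

lemma reach_long:
  assumes "reach 1 x x 0" "reach M x y c"
  shows "reach N x y c"
  using reach_mono[OF reach_trans[OF reach_loop_long[OF assms(1), of N] assms(2)], of N c] by simp

text \<open>The upper bound is the subsolution inequality. For the lower bound, follow calibrated preimages of \<open>y\<close>: any
accumulation point \<open>x\<close> of this backward orbit lies in the Aubry set, because the Birkhoff sums along it are
increments of the real function \<open>u\<close> underlying \<open>v\<close>, and the same segments show that
\<open>u y - u x\<close> is reached from \<open>x\<close> to \<open>y\<close>. The backward orbit also forces the eigenvalue to be \<open>Q\<close>.\<close>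
theorem eigenfunction_representation:
  assumes eig: "tropical_eigenfunction T A v"
  shows "v y = (SUP x\<in>aubry_set T A. v x \<otimes>\<^sub>t mane_potential T A x y)"
proof -
  obtain u k where v: "v = (\<lambda>x. ereal (u x))" and u: "continuous_on UNIV u"
    and sub: "\<And>y. u y + A y \<le> u (T y) + k"
    and cal: "\<And>x. \<exists>y. T y = x \<and> u y + A y = u x + k"
    by (rule tropical_eigenfunction_calibrated[OF comp T_cont A_cont eig]) (rule that)
  obtain g where g: "\<And>x. T (g x) = x" "\<And>x. u (g x) + A (g x) = u x + k" using cal by metis
  define w where "w j = (g ^^ j) y" for j
  have w: "(T ^^ i) (w (i + j)) = w j"
    "birkhoff_sum T A i (w (i + j)) = u (w j) - u (w (i + j)) + i * k" for i j
    using birkhoff_sum_calibrated_preorbit[of T g u A k i j y, OF g] by (auto simp: w_def)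
  obtain R where R: "0 < R" "\<And>x. \<bar>u x\<bar> \<le> R" using compact_UNIV_continuous_bounded[OF comp u] by blast
  have "Q \<le> k"
  proof (rule maximal_energy_le_if_birkhoff_sums_le[OF comp T_cont A_cont])
    show "birkhoff_sum T A n x \<le> n * k + 2 * R" for n x
      using birkhoff_sum_le_coboundary[of u A T k n x, OF sub] R(2)[of x] R(2)[of "(T ^^ n) x"] by linarith
  qed
  moreover have "k \<le> Q"
  proof (rule le_maximal_energy_if_birkhoff_sums_ge[OF comp T_cont A_cont filterlim_ident])
    show "real i * k - 2 * R \<le> birkhoff_sum T A i (w i)" for i
      using w(2)[of i 0] R(2)[of "w i"] R(2)[of "w 0"] by simp
  qed
  ultimately have k: "k = Q" by simp
  have S_le: "S n x \<le> u ((T ^^ n) x) - u x" for n x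
    using birkhoff_sum_le_coboundary[of u A T k n x, OF sub] by (simp add: birkhoff_sum_normalized k)
  have S_w: "S i (w (i + j)) = u (w j) - u (w (i + j))" for i j
    using w(2)[of i j] by (simp add: birkhoff_sum_normalized k)
  have reach_le: "c \<le> u y - u x" if r: "reach 1 x y c" for x c
  proof (rule field_le_epsilon)
    fix e :: real assume e: "0 < e"
    have "0 < e/3" using e by simp
    then have cont: "\<exists>d>0. \<forall>z. dist z p < d \<longrightarrow> dist (u z) (u p) < e/3" for p
      using u unfolding continuous_on_iff by blast
    obtain d where d: "0 < d" "\<And>z. dist z x < d \<Longrightarrow> dist (u z) (u x) < e/3"
      using cont[of x] by blast
    obtain d' where d': "0 < d'" "\<And>z. dist z y < d' \<Longrightarrow> dist (u z) (u y) < e/3"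
      using cont[of y] by blast
    define \<epsilon> where "\<epsilon> = min (e/3) (min (d/2) (d'/2))"
    have "0 < \<epsilon>" using e d d' by (simp add: \<epsilon>_def)
    from reachE[OF r this] obtain n z where
      z: "dist z x \<le> \<epsilon>" "dist ((T ^^ n) z) y \<le> \<epsilon>" "c - \<epsilon> \<le> S n z" by blast
    have "\<epsilon> < d" "\<epsilon> < d'" "\<epsilon> \<le> e/3" using d(1) d'(1) by (auto simp: \<epsilon>_def)
    then have "dist (u z) (u x) < e/3" "dist (u ((T ^^ n) z)) (u y) < e/3"
      using z d(2)[of z] d'(2)[of "(T ^^ n) z"] by auto
    then show "c \<le> u y - u x + e"
      using z(3) S_le[of n z] \<open>\<epsilon> \<le> e/3\<close> unfolding dist_real_def by linarith
  qed
  obtain x r where r: "strict_mono r" and x: "(\<lambda>j. w (r j)) \<longlonglongrightarrow> x"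
    using compact_UNIV_subsequence[OF comp] by blast
  have ux: "(\<lambda>j. u (w (r j))) \<longlonglongrightarrow> u x"
    using continuous_on_tendsto_compose[OF u x] by simp
  have near: "\<exists>N. \<forall>j\<ge>N. dist (w (r j)) x < \<epsilon> \<and> dist (u (w (r j))) (u x) < \<epsilon>" if "0 < \<epsilon>" for \<epsilon>
    using eventually_conj[OF tendstoD[OF x that] tendstoD[OF ux that]]
    by (simp add: eventually_sequentially)
  have aub: "x \<in> aubry_set T A"
    unfolding aubry_set_def
  proof (intro CollectI allI impI)
    fix \<epsilon> :: real assume "0 < \<epsilon>"
    then obtain N where N: "\<And>j. N \<le> j \<Longrightarrow> dist (w (r j)) x < \<epsilon>/2 \<and> dist (u (w (r j))) (u x) < \<epsilon>/2"
      using near[of "\<epsilon>/2"] by auto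
    define n where "n = r (Suc N) - r N"
    have n: "1 \<le> n" "r (Suc N) = n + r N"
      using strict_monoD[OF r, of N "Suc N"] by (auto simp: n_def)
    have "\<bar>u (w (r N)) - u x\<bar> < \<epsilon>/2" "\<bar>u (w (n + r N)) - u x\<bar> < \<epsilon>/2"
      using N[of N] N[of "Suc N"] unfolding dist_real_def n(2) by auto
    then have "\<bar>S n (w (n + r N))\<bar> \<le> \<epsilon>" unfolding S_w by linarith
    then show "\<exists>z. \<exists>n\<ge>1. dist x z \<le> \<epsilon> \<and> dist ((T ^^ n) z) x \<le> \<epsilon> \<and> \<bar>S n z\<bar> \<le> \<epsilon>"
      using N[of N] N[of "Suc N"] n w(1)[of n "r N"] \<open>0 < \<epsilon>\<close>
      by (intro exI[of _ "w (n + r N)"] exI[of _ n]) (auto simp: dist_commute)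
  qed
  have "reach 1 x y (u y - u x)"
  proof (rule reachI)
    fix \<epsilon> :: real assume e: "0 < \<epsilon>"
    then obtain N where N: "\<And>j. N \<le> j \<Longrightarrow> dist (w (r j)) x < \<epsilon> \<and> dist (u (w (r j))) (u x) < \<epsilon>"
      using near by blast
    define j where "j = Suc N"
    have j: "1 \<le> r j" "N \<le> j" using seq_suble[OF r, of j] by (auto simp: j_def)
    have "(T ^^ r j) (w (r j)) = y" "S (r j) (w (r j)) = u y - u (w (r j))"
      using w(1)[of "r j" 0] S_w[of "r j" 0] by (auto simp: w_def)
    then show "\<exists>n z. 1 \<le> n \<and> dist z x \<le> \<epsilon> \<and> dist ((T ^^ n) z) y \<le> \<epsilon> \<and> u y - u x - \<epsilon> \<le> S n z"
      using j N[OF j(2)] e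
      by (intro exI[of _ "r j"] exI[of _ "w (r j)"]) (auto simp: dist_real_def abs_less_iff)
  qed
  then have low: "ereal (u y - u x) \<le> mane_potential T A x y" by (simp add: mane_potential_ge_iff)
  show ?thesis
  proof (rule antisym)
    have "v y \<le> v x \<otimes>\<^sub>t mane_potential T A x y"
      using low mane_potential_not_PInf[of x y]
      by (cases "mane_potential T A x y") (auto simp: v)
    then show "v y \<le> (SUP x\<in>aubry_set T A. v x \<otimes>\<^sub>t mane_potential T A x y)"
      using aub by (rule SUP_upper2[rotated])
    show "(SUP x\<in>aubry_set T A. v x \<otimes>\<^sub>t mane_potential T A x y) \<le> v y"
    proof (rule SUP_least)
      fix x
      show "v x \<otimes>\<^sub>t mane_potential T A x y \<le> v y"
      proof (cases "mane_potential T A x y")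
        case (real c)
        then have "c \<le> u y - u x" using reach_le mane_potential_ge_iff[of c x y] by simp
        then show ?thesis by (simp add: v real)
      qed (use mane_potential_not_PInf in auto)
    qed
  qed
qed

text \<open>The set where \<open>b\<close> is finite is invariant in both time directions, hence dense by transitivity
and pullback. Every orbit segment can thus be shadowed by one ending in a finite set where \<open>b\<close> is bounded
below, which, for an eigenvalue \<open>k\<close>, bounds \<open>birkhoff_sum T A n x - n * k\<close> above and gives \<open>Q \<le> k\<close>; an orbit with finite density
gives \<open>k \<le> Q\<close>. Without transitivity a density supported on a closed invariant part may have another eigenvalue.\<close>
lemma transitive_eigendensity_eigenvalue:
  assumes op: "open_map euclidean euclidean T" and tr: "topologically_transitive T"
    and eig: "tropical_eigendensity T A b"
  shows "b (T x) \<otimes>\<^sub>t ereal (A x) = b x \<otimes>\<^sub>t ereal Q"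
proof -
  note b = tropical_eigendensityD[OF eig]
  obtain x0 where x0: "b x0 \<noteq> -\<infinity>" using b(3) by blast
  obtain \<kappa> where \<kappa>: "\<And>x. b (T x) \<otimes>\<^sub>t ereal (A x) = b x \<otimes>\<^sub>t \<kappa>" using b(4) by blast
  obtain k where k: "\<kappa> = ereal k"
  proof (cases \<kappa>)
    case PInf
    then show ?thesis using \<kappa>[of x0] x0 b(1)[of "T x0"] by (cases "b (T x0)"; cases "b x0") (auto simp: trop_mult_def)
  next
    case MInf
    have "b (T x) = -\<infinity>" for x
      using \<kappa>[of x] b(1)[of "T x"] MInf by (cases "b (T x)") auto
    moreover obtain z where "T z = x0" using open_transitive_imp_surj[OF comp T_cont op tr] by (metis surjD)
    ultimately show ?thesis using x0 by metis
  qed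
  have orb: "b ((T ^^ n) x) \<otimes>\<^sub>t ereal (birkhoff_sum T A n x) = b x \<otimes>\<^sub>t ereal (n * k)" for n x
    by (rule density_along_orbit) (use \<kappa> k in auto)
  obtain M where M: "\<And>x. b x < ereal M"
    using upper_semicontinuous_bounded_above[OF comp b(1,2)] by blast
  have fin: "\<exists>p q. b x = ereal p \<and> b ((T ^^ n) x) = ereal q \<and>
      birkhoff_sum T A n x = p - q + n * k \<and> p \<le> M \<and> q \<le> M"
    if "b x \<noteq> -\<infinity> \<or> b ((T ^^ n) x) \<noteq> -\<infinity>" for n x
    using that orb[of n x] M[of x] M[of "(T ^^ n) x"]
    by (cases "b x"; cases "b ((T ^^ n) x)") (auto simp: trop_mult_def)
  obtain p where p: "b x0 = ereal p" using x0 b(1)[of x0] by (cases "b x0") auto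
  have "k \<le> Q"
  proof (rule le_maximal_energy_if_birkhoff_sums_ge[OF comp T_cont A_cont filterlim_ident])
    fix n
    show "real n * k - (M - p) \<le> birkhoff_sum T A n x0"
      using fin[of x0 n] p by auto
  qed
  have dense: "\<exists>z. dist z u < h \<and> b z \<noteq> -\<infinity>" if h: "0 < h" for u h
  proof -
    define e where "e = min (h/2) \<rho>"
    have e: "0 < e" "e \<le> \<rho>" "e \<le> h/2" using h \<rho>_pos by (auto simp: e_def)
    obtain n where "(T ^^ n) ` ball u (h/2) \<inter> ball x0 e \<noteq> {}"
      using tr h e unfolding topologically_transitive_def
      by (metis centre_in_ball empty_iff half_gt_zero open_ball)
    then obtain z where "z \<in> ball u (h/2)" "(T ^^ n) z \<in> ball x0 e" by blast
    then have z: "dist u z < h/2" "dist ((T ^^ n) z) x0 \<le> e"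
      by (simp_all add: dist_commute)
    obtain z' where z': "(T ^^ n) z' = x0" "dist z z' \<le> e"
      using pullback[OF z(2) e(2)] by blast
    have "b z' \<noteq> -\<infinity>" using fin[of z' n] z' x0 by auto
    then show ?thesis
      using z z' e dist_triangle[of z' u z] by (intro exI[of _ z']) (auto simp: dist_commute)
  qed
  obtain F :: "'a set" where F: "finite F" "UNIV \<subseteq> (\<Union>d\<in>F. ball d (\<rho>/2))"
    using comp \<rho>_pos unfolding compact_eq_totally_bounded by (meson half_gt_zero)
  obtain z where z: "\<And>d. dist (z d) d < \<rho>/2" "\<And>d. b (z d) \<noteq> -\<infinity>"
    using dense[of "\<rho>/2"] \<rho>_pos by (metis half_gt_zero)
  (* a common lower bound for the density on the finite net; inserting 0 only guards against an empty set *)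
  define m where "m = Min (insert 0 ((\<lambda>d. real_of_ereal (b (z d))) ` F))"
  have "Q \<le> k"
  proof (rule maximal_energy_le_if_birkhoff_sums_le[OF comp T_cont A_cont])
    fix n x
    obtain d where d: "d \<in> F" "dist d ((T ^^ n) x) < \<rho>/2" using F(2) by fastforce
    have "dist ((T ^^ n) x) (z d) \<le> \<rho>"
      using d(2) z(1)[of d] dist_triangle[of "(T ^^ n) x" "z d" d] by (simp add: dist_commute)
    from pullback[OF this order_refl] obtain x' where
      x': "(T ^^ n) x' = z d" "S n x - K * \<rho> powr \<alpha> \<le> S n x'" by blast
    obtain p q where pq: "b (z d) = ereal q" "birkhoff_sum T A n x' = p - q + n * k" "p \<le> M"
      using fin[of x' n] z(2)[of d] x'(1) by auto
    have "m \<le> real_of_ereal (b (z d))" unfolding m_def using F(1) d(1) by (intro Min_le) auto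
    then have "m \<le> q" using pq by simp
    then show "birkhoff_sum T A n x \<le> n * k + (M - m + K * \<rho> powr \<alpha>)"
      using x'(2) pq by (simp add: birkhoff_sum_normalized)
  qed
  then have "k = Q" using \<open>k \<le> Q\<close> by simp
  then show ?thesis using \<kappa> k by simp
qed

text \<open>Exact preimages \<open>z\<close> of \<open>y\<close> close to \<open>x\<close> satisfy \<open>b z = b y + S n z\<close>, and upper semicontinuity passes
this lower bound on to \<open>x\<close>.\<close>
lemma density_ge_mane:
  assumes b: "\<And>x. b x \<noteq> \<infinity>" "\<And>c::real. open {x. b x < ereal c}"
    and eq: "\<And>x. b (T x) \<otimes>\<^sub>t ereal (A x) = b x \<otimes>\<^sub>t ereal Q"
  shows "mane_potential T A x y \<otimes>\<^sub>t b y \<le> b x"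
proof (cases "mane_potential T A x y"; cases "b y")
  fix c q assume c: "mane_potential T A x y = ereal c" and q: "b y = ereal q"
  have r: "reach 1 x y c" using mane_potential_ge_iff[of c x y] c by simp
  have "ereal (c + q) \<le> b x"
  proof (rule ccontr)
    assume "\<not> ?thesis"
    then obtain t where t: "b x < ereal t" "t < c + q"
      using ereal_dense2[of "b x" "ereal (c + q)"] by (auto simp: not_le)
    then obtain e where e: "0 < e" "ball x e \<subseteq> {x. b x < ereal t}"
      using b(2)[of t] by (metis mem_Collect_eq openE)
    define \<epsilon> where "\<epsilon> = min (e/2) (c + q - t)"
    have "0 < \<epsilon>" using e t by (simp add: \<epsilon>_def)
    from reach_exact[OF r this] obtain n z where
      z: "dist z x \<le> \<epsilon>" "(T ^^ n) z = y" "c - \<epsilon> \<le> S n z" by blast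
    have "z \<in> ball x e" using z(1) e(1) by (simp add: \<epsilon>_def dist_commute)
    then have "b z < ereal t" using e(2) by blast
    moreover have "b z = ereal (q + S n z)"
      using density_along_orbit[of b T A Q n z, OF eq] z(2) q b(1)[of z]
      by (cases "b z") (auto simp: birkhoff_sum_normalized)
    ultimately have "q + S n z < t" by simp
    then show False using z(3) by (simp add: \<epsilon>_def)
  qed
  then show ?thesis by (simp add: c q)
qed (use b(1) mane_potential_not_PInf in auto)

text \<open>Follow the forward orbit of \<open>x\<close>. The density along it is bounded above by semicontinuity and below
because Birkhoff sums are bounded above; hence the points and the densities accumulate jointly at some \<open>(y, \<tau>)\<close>. Density
increments are Birkhoff sums, so \<open>y\<close> is in the Aubry set, and \<open>\<tau> \<le> b y\<close> by semicontinuity.\<close>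
lemma density_attained_on_aubry_set:
  assumes b: "\<And>x. b x \<noteq> \<infinity>" "\<And>c::real. open {x. b x < ereal c}"
    and eq: "\<And>x. b (T x) \<otimes>\<^sub>t ereal (A x) = b x \<otimes>\<^sub>t ereal Q"
    and x: "b x \<noteq> -\<infinity>"
  obtains y where "y \<in> aubry_set T A" "b x \<le> mane_potential T A x y \<otimes>\<^sub>t b y"
proof -
  obtain \<beta> where \<beta>: "b x = ereal \<beta>" using x b(1)[of x] by (cases "b x") auto
  define t where "t n = \<beta> - S n x" for n
  have bt: "b ((T ^^ n) x) = ereal (t n)" for n
    using density_along_orbit[of b T A Q n x, OF eq] \<beta> b(1)[of "(T ^^ n) x"]
    by (cases "b ((T ^^ n) x)") (auto simp: birkhoff_sum_normalized t_def)
  obtain M where M: "\<And>x. b x < ereal M" using upper_semicontinuous_bounded_above[OF comp b] by blast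
  obtain C where C: "\<And>n x. S n x \<le> C" using birkhoff_sums_bounded_above by blast
  have tb: "t n \<in> {\<beta> - C..M}" for n
    using M[of "(T ^^ n) x"] C[of n x] bt[of n] by (simp add: t_def)
  have "compact ((UNIV :: 'a set) \<times> {\<beta> - C..M})" using comp by (intro compact_Times) auto
  then have "seq_compact ((UNIV :: 'a set) \<times> {\<beta> - C..M})" by (simp add: compact_eq_seq_compact_metric)
  then obtain l r where r: "strict_mono (r :: nat \<Rightarrow> nat)"
    and l: "((\<lambda>n. ((T ^^ n) x, t n)) \<circ> r) \<longlonglongrightarrow> l"
    by (rule seq_compactE[where f = "\<lambda>n. ((T ^^ n) x, t n)"]) (use tb in auto)
  define y \<tau> where "y = fst l" and "\<tau> = snd l"
  have y: "(\<lambda>k. (T ^^ r k) x) \<longlonglongrightarrow> y" and \<tau>: "(\<lambda>k. t (r k)) \<longlonglongrightarrow> \<tau>"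
    using tendsto_fst[OF l] tendsto_snd[OF l] by (simp_all add: y_def \<tau>_def comp_def)
  have near: "\<exists>N. \<forall>j\<ge>N. dist ((T ^^ r j) x) y < \<epsilon> \<and> dist (t (r j)) \<tau> < \<epsilon>" if "0 < \<epsilon>" for \<epsilon>
    using eventually_conj[OF tendstoD[OF y that] tendstoD[OF \<tau> that]]
    by (simp add: eventually_sequentially)
  have "ereal \<tau> \<le> b y"
  proof (rule ccontr)
    assume "\<not> ?thesis"
    then obtain q where q: "b y < ereal q" "q < \<tau>"
      using ereal_dense2[of "b y" "ereal \<tau>"] by (auto simp: not_le)
    have "\<forall>\<^sub>F k in sequentially. (T ^^ r k) x \<in> {x. b x < ereal q}"
      using topological_tendstoD[OF y b(2)] q by simp
    moreover have "\<forall>\<^sub>F k in sequentially. q < t (r k)" by (rule order_tendstoD(1)[OF \<tau> q(2)])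
    ultimately have "\<forall>\<^sub>F k in sequentially. False" by eventually_elim (simp add: bt)
    then show False by simp
  qed
  then obtain \<gamma> where \<gamma>: "b y = ereal \<gamma>" "\<tau> \<le> \<gamma>" using b(1)[of y] by (cases "b y") auto
  have "y \<in> aubry_set T A"
    unfolding aubry_set_def
  proof (intro CollectI allI impI)
    fix \<epsilon> :: real assume "0 < \<epsilon>"
    then obtain N where N: "\<And>j. N \<le> j \<Longrightarrow> dist ((T ^^ r j) x) y < \<epsilon>/2 \<and> dist (t (r j)) \<tau> < \<epsilon>/2"
      using near[of "\<epsilon>/2"] by auto
    define n where "n = r (Suc N) - r N"
    have n: "1 \<le> n" "r (Suc N) = r N + n"
      using strict_monoD[OF r, of N "Suc N"] by (auto simp: n_def)
    have pow: "(T ^^ n) ((T ^^ r N) x) = (T ^^ r (Suc N)) x"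
      by (simp add: n(2) funpow_add add.commute[of "r N"])
    have "S n ((T ^^ r N) x) = t (r N) - t (r (Suc N))"
      by (simp add: n(2) t_def birkhoff_sum_add)
    moreover have "\<bar>t (r N) - \<tau>\<bar> < \<epsilon>/2" "\<bar>t (r (Suc N)) - \<tau>\<bar> < \<epsilon>/2"
      using N[of N] N[of "Suc N"] unfolding dist_real_def by simp_all
    ultimately have "\<bar>S n ((T ^^ r N) x)\<bar> \<le> \<epsilon>" by linarith
    then show "\<exists>z. \<exists>n\<ge>1. dist y z \<le> \<epsilon> \<and> dist ((T ^^ n) z) y \<le> \<epsilon> \<and> \<bar>S n z\<bar> \<le> \<epsilon>"
      using N[of N] N[of "Suc N"] n(1) pow \<open>0 < \<epsilon>\<close>
      by (intro exI[of _ "(T ^^ r N) x"] exI[of _ n]) (auto simp: dist_commute)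
  qed
  moreover have "reach 1 x y (\<beta> - \<gamma>)"
  proof (rule reachI)
    fix \<epsilon> :: real assume e: "0 < \<epsilon>"
    then obtain N where N: "\<And>j. N \<le> j \<Longrightarrow> dist ((T ^^ r j) x) y < \<epsilon> \<and> dist (t (r j)) \<tau> < \<epsilon>"
      using near by blast
    define j where "j = Suc N"
    have j: "1 \<le> r j" "N \<le> j" using seq_suble[OF r, of j] by (auto simp: j_def)
    have "\<beta> - \<gamma> - \<epsilon> \<le> S (r j) x"
      using N[OF j(2)] \<gamma>(2) by (simp add: t_def dist_real_def abs_less_iff)
    then show "\<exists>n z. 1 \<le> n \<and> dist z x \<le> \<epsilon> \<and> dist ((T ^^ n) z) y \<le> \<epsilon> \<and> \<beta> - \<gamma> - \<epsilon> \<le> S n z"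
      using j N[OF j(2)] e by (intro exI[of _ "r j"] exI[of _ x]) auto
  qed
  then have "ereal (\<beta> - \<gamma>) \<le> mane_potential T A x y" by (simp add: mane_potential_ge_iff)
  then have "b x \<le> mane_potential T A x y \<otimes>\<^sub>t b y"
    using mane_potential_not_PInf[of x y] by (cases "mane_potential T A x y") (auto simp: \<gamma> \<beta>)
  ultimately show thesis using that by blast
qed

text \<open>The two previous lemmas show that \<open>b\<close> equals its Aubry representation pointwise, so a
test function \<open>f\<close> is just carried along.\<close>
theorem eigendensity_representation:
  assumes b: "\<And>x. b x \<noteq> \<infinity>" "\<And>c::real. open {x. b x < ereal c}"
    and eq: "\<And>x. b (T x) \<otimes>\<^sub>t ereal (A x) = b x \<otimes>\<^sub>t ereal Q"
  shows "(SUP x. ereal (f x) \<otimes>\<^sub>t b x) =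
    (SUP (x, y)\<in>UNIV \<times> aubry_set T A. ereal (f x) \<otimes>\<^sub>t mane_potential T A x y \<otimes>\<^sub>t b y)"
proof -
  have assoc: "ereal p \<otimes>\<^sub>t q \<otimes>\<^sub>t r = ereal p \<otimes>\<^sub>t (q \<otimes>\<^sub>t r)" for p q r
    by (cases q; cases r) (auto simp: trop_mult_def)
  have mono: "ereal p \<otimes>\<^sub>t q \<le> ereal p \<otimes>\<^sub>t r" if "q \<le> r" for p q r
    using that by (cases q; cases r) (auto simp: trop_mult_def)
  show ?thesis
  proof (rule antisym)
    show "(SUP x. ereal (f x) \<otimes>\<^sub>t b x)
      \<le> (SUP (x, y)\<in>UNIV \<times> aubry_set T A. ereal (f x) \<otimes>\<^sub>t mane_potential T A x y \<otimes>\<^sub>t b y)"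
    proof (rule SUP_least)
      fix x
      show "ereal (f x) \<otimes>\<^sub>t b x
        \<le> (SUP (x, y)\<in>UNIV \<times> aubry_set T A. ereal (f x) \<otimes>\<^sub>t mane_potential T A x y \<otimes>\<^sub>t b y)"
      proof (cases "b x = -\<infinity>")
        case False
        from density_attained_on_aubry_set[OF b eq False] obtain y where
          y: "y \<in> aubry_set T A" "b x \<le> mane_potential T A x y \<otimes>\<^sub>t b y" by blast
        show ?thesis
          using y mono[OF y(2), of "f x"] by (intro SUP_upper2[of "(x, y)"]) (auto simp: assoc)
      qed simp
    qed
    show "(SUP (x, y)\<in>UNIV \<times> aubry_set T A. ereal (f x) \<otimes>\<^sub>t mane_potential T A x y \<otimes>\<^sub>t b y)
      \<le> (SUP x. ereal (f x) \<otimes>\<^sub>t b x)"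
    proof (rule SUP_least, clarify)
      fix x y
      show "ereal (f x) \<otimes>\<^sub>t mane_potential T A x y \<otimes>\<^sub>t b y \<le> (SUP x. ereal (f x) \<otimes>\<^sub>t b x)"
        unfolding assoc by (rule SUP_upper2[of x]) (auto intro!: mono density_ge_mane[OF b eq])
    qed
  qed
qed

end

section \<open>Static classes and the Mane potential as an eigenvector\<close>

context shadowing_system
begin

text \<open>The first step of a segment can be dropped unless the segment has only that step. In the exceptional case
\<open>T x\<close> is near \<open>y\<close>, and the loop at \<open>y\<close> replaces the missing segment.\<close>
lemma reach_from_image:
  assumes loop: "reach 1 y y 0" and r: "reach 1 x y c"
  shows "reach 1 (T x) y (c - B x)"
proof (rule reachI)
  fix \<epsilon> :: real assume e: "0 < \<epsilon>"
  obtain d where d: "0 < d" "\<And>z. dist z x < d \<Longrightarrow> dist (T z) (T x) < \<epsilon>/2"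
    using T_cont half_gt_zero[OF e] unfolding continuous_on_iff by blast
  obtain d' where d': "0 < d'" "\<And>z. dist z x < d' \<Longrightarrow> dist (B z) (B x) < \<epsilon>/2"
    using normalized_cont half_gt_zero[OF e] unfolding continuous_on_iff by blast
  define \<delta> where "\<delta> = min (\<epsilon>/4) (min (d/2) (d'/2))"
  have \<delta>: "0 < \<delta>" "\<delta> \<le> \<epsilon>/4" "\<delta> < d" "\<delta> < d'" using e d d' by (auto simp: \<delta>_def)
  obtain n z where z: "1 \<le> n" "dist z x \<le> \<delta>" "dist ((T ^^ n) z) y \<le> \<delta>" "c - \<delta> \<le> S n z"
    using reachE[OF r \<delta>(1)] .
  have Tz: "dist (T z) (T x) < \<epsilon>/2" and "dist (B z) (B x) < \<epsilon>/2"
    using d(2)[of z] d'(2)[of z] z(2) \<delta> by auto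
  then have Bz: "B z < B x + \<epsilon>/2" unfolding dist_real_def by linarith
  obtain m where m: "n = Suc m" using z(1) by (cases n) auto
  have Sz: "S n z = B z + S m (T z)" by (simp add: m birkhoff_sum_Suc_left)
  have Tn: "(T ^^ n) z = (T ^^ m) (T z)" by (simp add: m funpow_swap1)
  show "\<exists>n z. 1 \<le> n \<and> dist z (T x) \<le> \<epsilon> \<and> dist ((T ^^ n) z) y \<le> \<epsilon> \<and> c - B x - \<epsilon> \<le> S n z"
  proof (cases "m = 0")
    case False
    then show ?thesis
      using z \<delta> Tz Bz Sz Tn by (intro exI[of _ m] exI[of _ "T z"]) auto
  next
    case True
    have near: "dist y (T x) \<le> 3 * \<epsilon> / 4"
      using z(3) Tn Tz True \<delta>(2) dist_triangle[of y "T x" "T z"] by (simp add: dist_commute)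
    have cB: "c - B x \<le> 3 * \<epsilon> / 4" using z(4) Sz True Bz \<delta>(2) by simp
    obtain k w where w: "1 \<le> k" "dist w y \<le> \<epsilon>/4" "dist ((T ^^ k) w) y \<le> \<epsilon>/4" "0 - \<epsilon>/4 \<le> S k w"
      using reachE[OF loop, of "\<epsilon>/4"] e by auto
    show ?thesis
      using w near cB e dist_triangle[of w "T x" y] by (intro exI[of _ k] exI[of _ w]) auto
  qed
qed

lemma reach_image_iff:
  assumes loop: "reach 1 y y 0"
  shows "reach 1 (T x) y (c - B x) \<longleftrightarrow> reach 1 x y c"
proof
  assume "reach 1 (T x) y (c - B x)"
  moreover have "reach 1 x (T x) (B x)" using reach_orbit[of 1 x] by simp
  ultimately show "reach 1 x y c" using reach_trans_1 by fastforce
qed (rule reach_from_image[OF loop])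

lemma reach_back_along_orbit:
  assumes loop: "reach 1 x x 0"
  shows "reach 1 ((T ^^ n) x) x (- S n x)"
proof (induction n)
  case (Suc n)
  have "reach 1 (T ((T ^^ n) x)) x (- S n x - B ((T ^^ n) x))"
    by (rule reach_from_image[OF loop Suc])
  then show ?case by (simp add: birkhoff_sum_def)
qed (use loop in simp)

text \<open>On the Aubry set this says that two points lie in the same static class. It is phrased with one reachable value
\<open>c\<close> and its negative, so that limits of linked pairs are obtained from a convergent subsequence of such values.\<close>
definition linked :: "'a \<Rightarrow> 'a \<Rightarrow> bool" where
  "linked x y \<longleftrightarrow> (\<exists>c. reach 1 x y c \<and> reach 1 y x (- c))"

lemma linked_sym: "linked x y \<Longrightarrow> linked y x"
  unfolding linked_def by (metis minus_minus)

lemma linked_trans: "linked x y \<Longrightarrow> linked y z \<Longrightarrow> linked x z"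
  unfolding linked_def using reach_trans_1 by (metis add.commute minus_add_distrib)

lemma linked_orbit:
  assumes loop: "reach 1 x x 0"
  shows "linked x ((T ^^ n) x)"
  unfolding linked_def
proof (intro exI conjI)
  show "reach 1 x ((T ^^ n) x) (S n x)" by (rule reach_long[OF loop reach_orbit])
  show "reach 1 ((T ^^ n) x) x (- S n x)" by (rule reach_back_along_orbit[OF loop])
qed

lemma closed_linked: "closed {y. linked x y}"
  unfolding closed_sequential_limits
proof (intro allI impI, elim conjE)
  fix f y assume f: "\<forall>n. f n \<in> {y. linked x y}" and lim: "f \<longlonglongrightarrow> y"
  obtain C where C: "0 \<le> C" "\<And>N x y c. reach N x y c \<Longrightarrow> c \<le> C" using reach_bounded by blast
  obtain c where c: "\<And>n. reach 1 x (f n) (c n)" "\<And>n. reach 1 (f n) x (- c n)"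
    using f unfolding linked_def mem_Collect_eq by metis
  have "c n \<in> {-C..C}" for n using C(2)[OF c(1)[of n]] C(2)[OF c(2)[of n]] by simp
  moreover have "seq_compact {-C..C}" using compact_Icc[of "-C" C] by (simp add: compact_eq_seq_compact_metric)
  ultimately obtain l r where r: "strict_mono (r :: nat \<Rightarrow> nat)" and "(c \<circ> r) \<longlonglongrightarrow> l"
    using seq_compactE[of "{-C..C}" c] by metis
  then have l: "(\<lambda>k. c (r k)) \<longlonglongrightarrow> l" by (simp add: comp_def)
  have fr: "(\<lambda>k. f (r k)) \<longlonglongrightarrow> y" using LIMSEQ_subseq_LIMSEQ[OF lim r] by (simp add: comp_def)
  have near: "\<exists>k. dist (f (r k)) y < \<epsilon> \<and> dist (c (r k)) l < \<epsilon>" if "0 < \<epsilon>" for \<epsilon>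
    using eventually_conj[OF tendstoD[OF fr that] tendstoD[OF l that]]
    by (auto simp: eventually_sequentially)
  have "reach 1 x y l"
  proof (rule reach_limit)
    fix \<epsilon> :: real assume e: "0 < \<epsilon>"
    then obtain k where "dist (f (r k)) y < \<epsilon>" "dist (c (r k)) l < \<epsilon>" using near by blast
    then show "\<exists>x' y' c'. dist x' x \<le> \<epsilon> \<and> dist y' y \<le> \<epsilon> \<and> l - \<epsilon> \<le> c' \<and> reach 1 x' y' c'"
      using c(1)[of "r k"] e
      by (intro exI[of _ x] exI[of _ "f (r k)"] exI[of _ "c (r k)"]) (auto simp: dist_real_def)
  qed
  moreover have "reach 1 y x (- l)"
  proof (rule reach_limit)
    fix \<epsilon> :: real assume e: "0 < \<epsilon>"
    then obtain k where "dist (f (r k)) y < \<epsilon>" "dist (c (r k)) l < \<epsilon>" using near by blast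
    then show "\<exists>x' y' c'. dist x' y \<le> \<epsilon> \<and> dist y' x \<le> \<epsilon> \<and> - l - \<epsilon> \<le> c' \<and> reach 1 x' y' c'"
      using c(2)[of "r k"] e
      by (intro exI[of _ "f (r k)"] exI[of _ x] exI[of _ "- c (r k)"]) (auto simp: dist_real_def)
  qed
  ultimately show "y \<in> {y. linked x y}" unfolding linked_def by blast
qed

text \<open>The class is closed and contains the orbit of \<open>x\<close>, so every limit of empirical measures
along this orbit is carried by it. The limit is maximizing because the return to \<open>x\<close> keeps the Birkhoff sums of \<open>x\<close> bounded below.\<close>
lemma maximizing_measure_on_linked_class:
  assumes loop: "reach 1 x x 0"
  obtains \<mu> where "\<mu> \<in> invariant_measures T" "integral\<^sup>L \<mu> A = Q" "AE y in \<mu>. linked x y"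
proof -
  obtain r \<mu> where r: "strict_mono r" and \<mu>: "\<mu> \<in> invariant_measures T" and
    lim: "\<And>f::'a \<Rightarrow> real. continuous_on UNIV f \<Longrightarrow>
       (\<lambda>k. birkhoff_sum T f (r k) x / r k) \<longlonglongrightarrow> integral\<^sup>L \<mu> f"
    by (rule krylov_bogolyubov[OF comp T_cont filterlim_ident, where x = "\<lambda>_. x"]) (rule that)
  interpret prob_space \<mu> using \<mu> by (simp add: invariant_measures_def)
  obtain C where C: "0 \<le> C" "\<And>N x y c. reach N x y c \<Longrightarrow> c \<le> C" using reach_bounded by blast
  have "real n * Q - C \<le> birkhoff_sum T A n x" for n
    using C(2)[OF reach_back_along_orbit[OF loop, of n]] by (simp add: birkhoff_sum_normalized)
  then have "Q \<le> integral\<^sup>L \<mu> A"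
    by (intro krylov_bogolyubov_integral_ge[OF lim[OF A_cont] filterlim_ident r])
  then have int: "integral\<^sup>L \<mu> A = Q"
    using integral_le_maximal_energy[OF comp A_cont \<mu>] by simp
  define F where "F y = infdist y {y. linked x y}" for y
  have ne: "{y. linked x y} \<noteq> {}" using linked_orbit[OF loop] by blast
  have Fc: "continuous_on UNIV F" unfolding F_def by (intro continuous_intros)
  have "F ((T ^^ i) x) = 0" for i using linked_orbit[OF loop] by (simp add: F_def)
  then have "birkhoff_sum T F n x = 0" for n by (simp add: birkhoff_sum_def)
  then have "integral\<^sup>L \<mu> F = 0"
    using lim[OF Fc] LIMSEQ_unique[OF _ tendsto_const] by fastforce
  moreover have "integrable \<mu> F" by (rule invariant_measure_integrable[OF comp \<mu> Fc])
  ultimately have "AE y in \<mu>. F y = 0"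
    using integral_nonneg_eq_0_iff_AE[of \<mu> F] by (simp add: F_def infdist_nonneg)
  then have "AE y in \<mu>. linked x y"
  proof (rule AE_mp, intro AE_I2 impI)
    fix y assume "F y = 0"
    then show "linked x y"
      using in_closed_iff_infdist_zero[OF closed_linked ne, of y] by (simp add: F_def)
  qed
  then show thesis using that \<mu> int by blast
qed

text \<open>Both classes carry the same measure, so they share a point.\<close>
lemma uniquely_maximizing_imp_linked:
  assumes uniq: "uniquely_maximizing T A" and x: "reach 1 x x 0" and x': "reach 1 x' x' 0"
  shows "linked x x'"
proof -
  obtain \<mu> where \<mu>: "\<mu> \<in> invariant_measures T" "integral\<^sup>L \<mu> A = Q" "AE y in \<mu>. linked x y"
    using maximizing_measure_on_linked_class[OF x] .
  obtain \<mu>' where \<mu>': "\<mu>' \<in> invariant_measures T" "integral\<^sup>L \<mu>' A = Q" "AE y in \<mu>'. linked x' y"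
    using maximizing_measure_on_linked_class[OF x'] .
  have "\<mu>' = \<mu>" using uniq \<mu> \<mu>' unfolding uniquely_maximizing_def by blast
  then have AE: "AE y in \<mu>. linked x y \<and> linked x' y" using \<mu>(3) \<mu>'(3) by auto
  interpret prob_space \<mu> using \<mu> by (simp add: invariant_measures_def)
  have "\<exists>y. linked x y \<and> linked x' y"
  proof (rule ccontr)
    assume none: "\<not> ?thesis"
    have "AE y in \<mu>. linked x y \<and> linked x' y \<longrightarrow> False" by (rule AE_I2) (use none in blast)
    with AE have "AE y in \<mu>. False" by (rule AE_mp)
    then show False by simp
  qed
  then obtain y where "linked x y" "linked x' y" by blast
  then show ?thesis using linked_trans linked_sym by blast
qed

lemma mane_potential_shift_if_linked:
  assumes "linked x x'"
  shows "\<exists>c::real. \<forall>y. mane_potential T A x' y = mane_potential T A x y \<otimes>\<^sub>t ereal c"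
    and "\<exists>c::real. \<forall>y. mane_potential T A y x' = mane_potential T A y x \<otimes>\<^sub>t ereal c"
proof -
  obtain c where c: "reach 1 x x' c" "reach 1 x' x (- c)" using assms unfolding linked_def by blast
  have "reach 1 x' y d \<longleftrightarrow> reach 1 x y (d - (- c))" for y d
    using reach_trans_1[OF c(1), of y d] reach_trans_1[OF c(2), of y "d + c"]
    by (auto simp: add.commute)
  then show "\<exists>c::real. \<forall>y. mane_potential T A x' y = mane_potential T A x y \<otimes>\<^sub>t ereal c"
    using mane_potential_eq_shift by blast
  have "reach 1 y x' d \<longleftrightarrow> reach 1 y x (d - c)" for y d
    using reach_trans_1[OF _ c(1), of y "d - c"] reach_trans_1[OF _ c(2), of y d] by auto
  then show "\<exists>c::real. \<forall>y. mane_potential T A y x' = mane_potential T A y x \<otimes>\<^sub>t ereal c"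
    using mane_potential_eq_shift by blast
qed

text \<open>Finiteness at \<open>y\<close> comes from the loop, semicontinuity from closedness of reachability, and the
eigenvalue equation from splitting off the first step.\<close>
theorem mane_potential_eigendensity:
  assumes loop: "reach 1 y y 0"
  shows "tropical_eigendensity T A (\<lambda>x. mane_potential T A x y)"
  unfolding tropical_eigendensity_def
proof (intro conjI)
  let ?b = "\<lambda>x. mane_potential T A x y"
  have "open {x. ?b x < ereal c}" for c
  proof -
    have "closed {x. reach 1 x y c}"
      unfolding closed_sequential_limits
    proof (intro allI impI, elim conjE)
      fix f x assume f: "\<forall>n. f n \<in> {x. reach 1 x y c}" and lim: "f \<longlonglongrightarrow> x"
      have "reach 1 x y c"
      proof (rule reach_limit)
        fix \<epsilon> :: real assume e: "0 < \<epsilon>"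
        obtain n where "dist (f n) x < \<epsilon>"
          using tendstoD[OF lim e] by (auto simp: eventually_sequentially)
        then show "\<exists>x' y' c'. dist x' x \<le> \<epsilon> \<and> dist y' y \<le> \<epsilon> \<and> c - \<epsilon> \<le> c' \<and> reach 1 x' y' c'"
          using f e by (intro exI[of _ "f n"] exI[of _ y] exI[of _ c]) auto
      qed
      then show "x \<in> {x. reach 1 x y c}" by simp
    qed
    moreover have "{x. ?b x < ereal c} = - {x. reach 1 x y c}"
      unfolding mane_potential_ge_iff[symmetric] by (auto simp: not_le)
    ultimately show ?thesis by (simp add: open_Compl)
  qed
  moreover have "?b y \<noteq> -\<infinity>" using mane_potential_ge_iff[of 0 y y] loop by auto
  ultimately show "?b \<in> tropical_densities - {\<lambda>x. \<infinity>, \<lambda>x. -\<infinity>}"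
    using mane_potential_not_PInf unfolding tropical_densities_def by (auto dest: fun_cong)
  have shift: "?b x = ?b (T x) \<otimes>\<^sub>t ereal (B x)" for x
    by (rule mane_potential_eq_shift) (rule reach_image_iff[OF loop, symmetric])
  have "bousch_adjoint T A ?b x = ?b x \<otimes>\<^sub>t ereal Q" for x
    unfolding bousch_adjoint_def shift[of x] using mane_potential_not_PInf[of "T x" y]
    by (cases "?b (T x)") (auto simp: normalized_def)
  then show "\<exists>\<kappa>. bousch_adjoint T A ?b = (\<lambda>x. ?b x \<otimes>\<^sub>t \<kappa>)" by blast
qed

text \<open>Because loops at \<open>x\<close> can be prefixed, segments from \<open>x\<close> to \<open>y\<close> may be taken so long that moving their endpoint by a
fixed distance \<open>D\<close> hardly moves their starting point. This makes the potential Hoelder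
continuous in its second argument wherever it is finite.\<close>
lemma reach_move_endpoint:
  assumes loop: "reach 1 x x 0" and r: "reach 1 x y c" and D: "dist y y' \<le> D" "D \<le> \<rho>"
  shows "reach 1 x y' (c - K * D powr \<alpha>)"
proof (rule reachI)
  fix \<epsilon> :: real assume e: "0 < \<epsilon>"
  have D0: "0 \<le> D" using order_trans[OF zero_le_dist D(1)] .
  (* segments longer than N move their starting point by at most half the tolerance *)
  obtain N where N: "s ^ N * D \<le> \<epsilon>/2"
  proof (cases "D = 0")
    case False
    then have "0 < \<epsilon>/2/D" using e D0 by simp
    then obtain N where "s ^ N < \<epsilon>/2/D" using real_arch_pow_inv[OF _ s_less] by blast
    then show ?thesis using that[of N] False D0 by (simp add: field_simps)
  qed (use e in auto)
  obtain n z where z: "Suc N \<le> n" "dist z x \<le> \<epsilon>/2" "(T ^^ n) z = y" "c - \<epsilon>/2 \<le> S n z"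
    using reach_exact[OF reach_long[OF loop r, of "Suc N"], of "\<epsilon>/2"] e by auto
  obtain z' where z': "(T ^^ n) z' = y'" "dist z z' \<le> s ^ n * D" "S n z - K * D powr \<alpha> \<le> S n z'"
    using pullback[of n z y' D] z(3) D by auto
  have "s ^ n * D \<le> s ^ N * D"
    using z(1) s_pos s_less D0 by (intro mult_right_mono power_decreasing) auto
  then show "\<exists>n z. 1 \<le> n \<and> dist z x \<le> \<epsilon> \<and> dist ((T ^^ n) z) y' \<le> \<epsilon> \<and> c - K * D powr \<alpha> - \<epsilon> \<le> S n z"
    using z z' N e dist_triangle[of z' x z]
    by (intro exI[of _ n] exI[of _ z']) (auto simp: dist_commute)
qed

text \<open>Transitivity joins a neighbourhood of fixed size of \<open>x\<close> to \<open>y\<close>, and the loops at \<open>x\<close> reach every point of that neighbourhood.\<close>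
lemma mane_potential_finite_if_transitive:
  assumes tr: "topologically_transitive T" and loop: "reach 1 x x 0"
  shows "\<exists>c. reach 1 x y c"
proof -
  define e where "e = \<rho>/2"
  have e: "0 < e" "e \<le> \<rho>" using \<rho>_pos by (auto simp: e_def)
  obtain n where "(T ^^ n) ` ball x e \<inter> ball y e \<noteq> {}"
    using tr e unfolding topologically_transitive_def
    by (metis centre_in_ball empty_iff open_ball)
  then obtain w where "w \<in> ball x e" "(T ^^ n) w \<in> ball y e" by blast
  then have w: "dist x w < e" "dist ((T ^^ n) w) y \<le> e" by (simp_all add: dist_commute)
  obtain w' where w': "(T ^^ n) w' = y" "dist w w' \<le> e" using pullback[OF w(2) e(2)] by blast
  have "dist x w' \<le> \<rho>" using w w' dist_triangle[of x w' w] by (simp add: e_def)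
  then have "reach 1 x w' (0 - K * \<rho> powr \<alpha>)" by (rule reach_move_endpoint[OF loop loop _ order_refl])
  moreover have "reach n w' y (S n w')" using reach_orbit[of n w'] w'(1) by simp
  ultimately have "reach (1 + n) x y (0 - K * \<rho> powr \<alpha> + S n w')" by (rule reach_trans)
  then have "reach 1 x y (0 - K * \<rho> powr \<alpha> + S n w')" by (rule reach_mono) simp_all
  then show ?thesis by (rule exI)
qed

text \<open>One inequality of the eigenvalue equation is the triangle inequality. For the other, nearly
optimal segments of length at least two end in a preimage of the given point followed by one step, and a limit of these preimages
attains the supremum.\<close>
theorem mane_potential_eigenfunction:
  assumes tr: "topologically_transitive T" and loop: "reach 1 x x 0"
  shows "tropical_eigenfunction T A (\<lambda>y. mane_potential T A x y)"
proof -
  have "\<exists>c. mane_potential T A x y = ereal c" for y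
  proof -
    obtain c where "reach 1 x y c" using mane_potential_finite_if_transitive[OF tr loop] by blast
    then have "ereal c \<le> mane_potential T A x y" by (simp add: mane_potential_ge_iff)
    then show ?thesis using mane_potential_not_PInf[of x y] by (cases "mane_potential T A x y") auto
  qed
  then obtain u where u: "\<And>y. mane_potential T A x y = ereal (u y)" by metis
  have ru: "reach 1 x y c \<longleftrightarrow> c \<le> u y" for y c
    unfolding mane_potential_ge_iff[symmetric] u by simp
  have lower: "u y - K * D powr \<alpha> \<le> u y'" if "dist y y' \<le> D" "D \<le> \<rho>" for y y' D
  proof -
    have "reach 1 x y (u y)" unfolding ru by simp
    from reach_move_endpoint[OF loop this that] show ?thesis unfolding ru .
  qed
  have "continuous_on UNIV u"
    unfolding continuous_on_iff
  proof (intro ballI allI impI)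
    fix y and e :: real assume "0 < e"
    then obtain \<delta> where \<delta>: "0 < \<delta>" "\<delta> \<le> \<rho>" "K * \<delta> powr \<alpha> \<le> e/2"
      using small_scale[of "e/2"] by auto
    show "\<exists>d>0. \<forall>y'\<in>UNIV. dist y' y < d \<longrightarrow> dist (u y') (u y) < e"
    proof (intro exI[of _ \<delta>] conjI ballI impI)
      fix y' assume "dist y' y < \<delta>"
      then show "dist (u y') (u y) < e"
        using lower[of y y' \<delta>] lower[of y' y \<delta>] \<delta> \<open>0 < e\<close>
        by (simp add: dist_commute dist_real_def abs_less_iff)
    qed (rule \<delta>(1))
  qed
  then have uc: "(\<lambda>y. mane_potential T A x y) \<in> real_continuous_functions"
    unfolding real_continuous_functions_def u by blast
  have step: "u z + B z \<le> u (T z)" for z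
  proof -
    have "reach 1 x z (u z)" unfolding ru by simp
    moreover have "reach 1 z (T z) (B z)" using reach_orbit[of 1 z] by simp
    ultimately have "reach 1 x (T z) (u z + B z)" by (rule reach_trans_1)
    then show ?thesis unfolding ru .
  qed
  have attained: "\<exists>z. T z = y \<and> u y \<le> u z + B z" for y
  proof -
    (* at least two steps, so that a segment of at least one step remains after removing the last one *)
    have "\<exists>n z. 2 \<le> n \<and> dist z x \<le> 1 / Suc k \<and> (T ^^ n) z = y \<and> u y - 1 / Suc k \<le> S n z" for k
    proof -
      have "reach 2 x y (u y)" by (rule reach_long[OF loop, of 1]) (unfold ru, rule order_refl)
      from reach_exact[OF this, of "1 / Suc k"] show ?thesis by (metis of_nat_0_less_iff zero_less_Suc zero_less_divide_1_iff)
    qed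
    then obtain n z where nz: "\<And>k. 2 \<le> n k" "\<And>k. dist (z k) x \<le> 1 / Suc k"
      "\<And>k. (T ^^ n k) (z k) = y" "\<And>k. u y - 1 / Suc k \<le> S (n k) (z k)" by metis
    define p where "p k = (T ^^ (n k - 1)) (z k)" for k
    have nk: "n k = Suc (n k - 1)" for k using nz(1)[of k] by simp
    have Tp: "T (p k) = y" for k
      using nz(3)[of k] nk[of k] unfolding p_def by (metis comp_apply funpow.simps(2))
    have Sp: "u y - 1 / Suc k - B (p k) \<le> S (n k - 1) (z k)" for k
    proof -
      have "S (n k) (z k) = S (n k - 1) (z k) + B (p k)"
        using birkhoff_sum_add[of T B "n k - 1" 1 "z k"] nk[of k] by (simp add: p_def)
      then show ?thesis using nz(4)[of k] by simp
    qed
    obtain l r where r: "strict_mono r" and l: "(\<lambda>k. p (r k)) \<longlonglongrightarrow> l"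
      using compact_UNIV_subsequence[OF comp] by blast
    have "(\<lambda>k. T (p (r k))) \<longlonglongrightarrow> T l"
      using continuous_on_tendsto_compose[OF T_cont l] by simp
    then have Tl: "T l = y" using LIMSEQ_unique[OF tendsto_const, of y "T l"] by (simp add: Tp)
    have Bl: "(\<lambda>k. B (p (r k))) \<longlonglongrightarrow> B l"
      using continuous_on_tendsto_compose[OF normalized_cont l] by simp
    have "reach 1 x l (u y - B l)"
    proof (rule reachI)
      fix \<epsilon> :: real assume e: "0 < \<epsilon>"
      obtain j :: nat where j: "1 / Suc j < \<epsilon>/2"
        using reals_Archimedean[of "\<epsilon>/2"] e by (auto simp: field_simps)
      have "\<forall>\<^sub>F k in sequentially. j \<le> k \<and> dist (p (r k)) l < \<epsilon> \<and> dist (B (p (r k))) (B l) < \<epsilon>/2"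
        using e by (intro eventually_conj eventually_ge_at_top tendstoD[OF l] tendstoD[OF Bl]) auto
      then obtain k where k: "j \<le> k" "dist (p (r k)) l < \<epsilon>" "dist (B (p (r k))) (B l) < \<epsilon>/2"
        by (auto simp: eventually_sequentially)
      have "j \<le> r k" using k(1) seq_suble[OF r, of k] by simp
      then have "1 / Suc (r k) \<le> 1 / Suc j" by (intro divide_left_mono) auto
      then have small: "1 / Suc (r k) < \<epsilon>/2" using j by simp
      have "u y - B l - \<epsilon> \<le> S (n (r k) - 1) (z (r k))"
        using Sp[of "r k"] small k(3) unfolding dist_real_def by linarith
      then show "\<exists>n z. 1 \<le> n \<and> dist z x \<le> \<epsilon> \<and> dist ((T ^^ n) z) l \<le> \<epsilon> \<and> u y - B l - \<epsilon> \<le> S n z"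
        using nz(1)[of "r k"] nz(2)[of "r k"] small k(2) e
        by (intro exI[of _ "n (r k) - 1"] exI[of _ "z (r k)"]) (auto simp: p_def)
    qed
    then have "u y \<le> u l + B l" unfolding ru by simp
    then show ?thesis using Tl by blast
  qed
  have "bousch T A (\<lambda>y. ereal (u y)) y = ereal (u y) \<otimes>\<^sub>t ereal Q" for y
  proof -
    have "(SUP z\<in>T -` {y}. ereal (u z + A z)) = ereal (u y + Q)"
    proof (rule antisym)
      show "(SUP z\<in>T -` {y}. ereal (u z + A z)) \<le> ereal (u y + Q)"
      proof (rule SUP_least)
        fix z assume "z \<in> T -` {y}"
        then show "ereal (u z + A z) \<le> ereal (u y + Q)"
          using step[of z] by (simp add: normalized_def)
      qed
      obtain z where "T z = y" "u y \<le> u z + B z" using attained by blast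
      then show "ereal (u y + Q) \<le> (SUP z\<in>T -` {y}. ereal (u z + A z))"
        by (intro SUP_upper2[of z]) (auto simp: normalized_def)
    qed
    then show ?thesis by (simp add: bousch_def)
  qed
  then have "bousch T A (\<lambda>y. mane_potential T A x y) = (\<lambda>y. mane_potential T A x y \<otimes>\<^sub>t ereal Q)"
    unfolding u by blast
  then show ?thesis using uc unfolding tropical_eigenfunction_def by blast
qed

end

theorem theorem4:
  fixes T :: "'a::metric_space \<Rightarrow> 'a" and A :: "'a \<Rightarrow> real" and \<alpha> :: real
  assumes "compact (UNIV :: 'a set)"
    and "continuous_on UNIV T"
    and "open_map euclidean euclidean T"
    and "distance_expanding T"
    and "0 < \<alpha>" and "\<alpha> \<le> 1"
    and "holder_continuous \<alpha> A"
  shows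
    "(\<forall>v. tropical_eigenfunction T A v \<longrightarrow>
        (\<forall>y. v y = (SUP x\<in>aubry_set T A. v x \<otimes>\<^sub>t mane_potential T A x y)))
     \<and>
     (\<forall>b. tropical_eigendensity T A b \<longrightarrow>
        (topologically_transitive T \<or>
         bousch_adjoint T A b = (\<lambda>x. b x \<otimes>\<^sub>t ereal (maximal_energy T A))) \<longrightarrow>
        (\<forall>f::'a \<Rightarrow> real. continuous_on UNIV f \<longrightarrow>
           (SUP x. ereal (f x) \<otimes>\<^sub>t b x) =
           (SUP (x, y)\<in>UNIV \<times> aubry_set T A.
              ereal (f x) \<otimes>\<^sub>t mane_potential T A x y \<otimes>\<^sub>t b y)))
     \<and>
     (uniquely_maximizing T A \<longrightarrow>
        (\<forall>x\<in>aubry_set T A. \<forall>x'\<in>aubry_set T A.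
           \<exists>c::real. \<forall>y. mane_potential T A x' y = mane_potential T A x y \<otimes>\<^sub>t ereal c)
        \<and>
        (\<forall>y\<in>aubry_set T A. \<forall>y'\<in>aubry_set T A.
           \<exists>c::real. \<forall>x. mane_potential T A x y' = mane_potential T A x y \<otimes>\<^sub>t ereal c)
        \<and>
        (\<forall>y\<in>aubry_set T A. tropical_eigendensity T A (\<lambda>x. mane_potential T A x y))
        \<and>
        (topologically_transitive T \<longrightarrow>
           (\<forall>x\<in>aubry_set T A. tropical_eigenfunction T A (\<lambda>y. mane_potential T A x y))))"
proof -
  have A_cont: "continuous_on UNIV A"
    by (rule holder_continuous_imp_continuous[OF assms(5,7)])
  obtain s \<rho> K where "0 < s" "s < 1" "0 < \<rho>" "0 \<le> K"
    "\<And>n x y. dist ((T ^^ n) x) y \<le> \<rho> \<Longrightarrow> \<exists>x'. (T ^^ n) x' = y \<and>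
        dist x x' \<le> s ^ n * dist ((T ^^ n) x) y \<and>
        \<bar>birkhoff_sum T A n x - birkhoff_sum T A n x'\<bar> \<le> K * dist ((T ^^ n) x) y powr \<alpha>"
    by (rule expanding_pullback[OF assms(1-5,7)]) (rule that)
  then interpret shadowing_system T A \<alpha> \<rho> K s
    using assms A_cont by unfold_locales auto
  show ?thesis
  proof (intro conjI allI impI ballI)
    fix v y assume "tropical_eigenfunction T A v"
    then show "v y = (SUP x\<in>aubry_set T A. v x \<otimes>\<^sub>t mane_potential T A x y)"
      by (rule eigenfunction_representation)
  next
    fix b and f :: "'a \<Rightarrow> real"
    assume b: "tropical_eigendensity T A b"
      and "topologically_transitive T \<or> bousch_adjoint T A b = (\<lambda>x. b x \<otimes>\<^sub>t ereal (maximal_energy T A))"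
    then have "b (T x) \<otimes>\<^sub>t ereal (A x) = b x \<otimes>\<^sub>t ereal (maximal_energy T A)" for x
      using transitive_eigendensity_eigenvalue[OF assms(3) _ b]
      by (auto simp: bousch_adjoint_def fun_eq_iff)
    then show "(SUP x. ereal (f x) \<otimes>\<^sub>t b x) =
       (SUP (x, y)\<in>UNIV \<times> aubry_set T A. ereal (f x) \<otimes>\<^sub>t mane_potential T A x y \<otimes>\<^sub>t b y)"
      by (rule eigendensity_representation[OF tropical_eigendensityD(1,2)[OF b]])
  next
    fix x x' assume "uniquely_maximizing T A" "x \<in> aubry_set T A" "x' \<in> aubry_set T A"
    then have "linked x x'" by (intro uniquely_maximizing_imp_linked aubry_imp_reach)
    then show "\<exists>c::real. \<forall>y. mane_potential T A x' y = mane_potential T A x y \<otimes>\<^sub>t ereal c"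
      and "\<exists>c::real. \<forall>y. mane_potential T A y x' = mane_potential T A y x \<otimes>\<^sub>t ereal c"
      by (rule mane_potential_shift_if_linked)+
  next
    fix y assume "y \<in> aubry_set T A"
    then show "tropical_eigendensity T A (\<lambda>x. mane_potential T A x y)"
      by (intro mane_potential_eigendensity aubry_imp_reach)
  next
    fix x assume "topologically_transitive T" "x \<in> aubry_set T A"
    then show "tropical_eigenfunction T A (\<lambda>y. mane_potential T A x y)"
      by (intro mane_potential_eigenfunction aubry_imp_reach)
  qed
qed

end
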